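(* Let $F_2$ be the free group of rank $2$ with basis $X=\{a,b\}$. (1) For every integer $d\ge 1$ there exists a rational subset $U_d\subseteq F_2$ such that the relative conjugacy growth function $c_{F_2,X,U_d}(n)$ grows polynomially of degree $d-1$, i.e. $c_{F_2,X,U_d}(n)=\Theta(n^{d-1})$ as $n\to\infty$, and the associated power series $\sum_{n\ge 0} c_{F_2,X,U_d}(n)z^n$ is a rational function of $z$. (2) There is no rational subset of $F_2$ with intermediate relative conjugacy growth: for every rational subset $U\subseteq F_2$, the function $c_{F_2,X,U}(n)$ is either bounded above by a polynomial in $n$ or grows exponentially, i.e. $\limsup_{n\to\infty} c_{F_2,X,U}(n)^{1/n}>1$.
   Context: Let $G$ be a group with finite generating set $X\subseteq G$, let $\widetilde X=X\cup X^{-1}$ and let $\pi:\widetilde X^*\to G$ be the canonical surjective monoid homomorphism. For $g\in G$, $|g|$ is the length of a shortest word over $\widetilde X$ representing $g$, $[g]$ is the conjugacy class of $g$, and $|g|_c=\min\{|h| : h\in[g]\}$. For a subset $U\subseteq G$, the (strict) conjugacy growth function relative to $U$ is $$c_{G,X,U}(n)=\#\{[g] : |g|_c=n \text{ and } [g]\cap U\neq\emptyset\}.$$ A subset $U\subseteq G$ is rational if there is a regular language $L\subseteq\widetilde X^*$ with $L\pi=U$. *)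

theory Defs
  imports
    "HOL-Algebra.Generated_Groups"
    "HOL-Computational_Algebra.Polynomial_FPS"
    "HOL-Library.Landau_Symbols"
    "HOL-Library.Extended_Real"
    "HOL-Library.Liminf_Limsup"
begin

section \<open>Words over a generating set\<close>

definition sym_gens :: "('g, 'm) monoid_scheme \<Rightarrow> 'g set \<Rightarrow> 'g set" where
  "sym_gens G X = X \<union> (\<lambda>x. inv\<^bsub>G\<^esub> x) ` X"

text \<open>The canonical monoid homomorphism from words over the symmetrised generating set to the group.\<close>

definition word_eval :: "('g, 'm) monoid_scheme \<Rightarrow> 'g list \<Rightarrow> 'g" where
  "word_eval G w = foldr (\<lambda>x y. x \<otimes>\<^bsub>G\<^esub> y) w \<one>\<^bsub>G\<^esub>"

definition word_length :: "('g, 'm) monoid_scheme \<Rightarrow> 'g set \<Rightarrow> 'g \<Rightarrow> nat" where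
  "word_length G X g =
     (LEAST n. \<exists>w \<in> lists (sym_gens G X). word_eval G w = g \<and> length w = n)"


section \<open>Relative conjugacy growth\<close>

definition conj_class :: "('g, 'm) monoid_scheme \<Rightarrow> 'g \<Rightarrow> 'g set" where
  "conj_class G g = {h \<otimes>\<^bsub>G\<^esub> g \<otimes>\<^bsub>G\<^esub> inv\<^bsub>G\<^esub> h | h. h \<in> carrier G}"

definition conj_length :: "('g, 'm) monoid_scheme \<Rightarrow> 'g set \<Rightarrow> 'g \<Rightarrow> nat" where
  "conj_length G X g = (LEAST n. \<exists>h \<in> conj_class G g. word_length G X h = n)"

definition conj_growth ::
    "('g, 'm) monoid_scheme \<Rightarrow> 'g set \<Rightarrow> 'g set \<Rightarrow> nat \<Rightarrow> nat" where
  "conj_growth G X U n =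
     card {conj_class G g | g.
             g \<in> carrier G \<and> conj_length G X g = n \<and> conj_class G g \<inter> U \<noteq> {}}"


section \<open>Rational subsets\<close>

text \<open>A language over the alphabet \<open>A\<close> is regular if it is accepted by a complete deterministic
  finite automaton; taking states in \<^typ>\<open>nat\<close> loses no generality.\<close>

definition regular_language :: "'l set \<Rightarrow> 'l list set \<Rightarrow> bool" where
  "regular_language A L \<longleftrightarrow>
     (\<exists>(Q :: nat set) (\<delta> :: nat \<Rightarrow> 'l \<Rightarrow> nat) q\<^sub>0 F.
        finite Q \<and> q\<^sub>0 \<in> Q \<and> F \<subseteq> Q \<and> (\<forall>q \<in> Q. \<forall>x \<in> A. \<delta> q x \<in> Q) \<and>
        L = {w \<in> lists A. foldl \<delta> q\<^sub>0 w \<in> F})"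

definition rational_subset :: "('g, 'm) monoid_scheme \<Rightarrow> 'g set \<Rightarrow> 'g set \<Rightarrow> bool" where
  "rational_subset G X U \<longleftrightarrow>
     (\<exists>L. regular_language (sym_gens G X) L \<and> word_eval G ` L = U)"


section \<open>Rational power series\<close>

definition rational_fps :: "'f :: field fps \<Rightarrow> bool" where
  "rational_fps f \<longleftrightarrow>
     (\<exists>p q. coeff q 0 \<noteq> 0 \<and> f = fps_of_poly p / fps_of_poly q)"


section \<open>Free groups\<close>

text \<open>The free group on a set \<open>S\<close> consists of the freely reduced words over the signed letters
  \<open>(s, True)\<close> (standing for \<open>s\<close>) and \<open>(s, False)\<close> (standing for the inverse of \<open>s\<close>).
  The product is concatenation followed by free reduction, performed letter by letter from the
  right.\<close>

definition inv_letter :: "'s \<times> bool \<Rightarrow> 's \<times> bool" where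
  "inv_letter x = (fst x, \<not> snd x)"

definition reduced :: "('s \<times> bool) list \<Rightarrow> bool" where
  "reduced w \<longleftrightarrow> successively (\<lambda>x y. y \<noteq> inv_letter x) w"

fun push_letter :: "'s \<times> bool \<Rightarrow> ('s \<times> bool) list \<Rightarrow> ('s \<times> bool) list" where
  "push_letter x [] = [x]"
| "push_letter x (y # w) = (if y = inv_letter x then w else x # y # w)"

definition free_group :: "'s set \<Rightarrow> ('s \<times> bool) list monoid" where
  "free_group S =
     \<lparr>carrier = {w \<in> lists (S \<times> UNIV). reduced w},
      monoid.mult = (\<lambda>u v. foldr push_letter u v),
      one = []\<rparr>"

definition free_basis :: "'s set \<Rightarrow> ('s \<times> bool) list set" where
  "free_basis S = (\<lambda>s. [(s, True)]) ` S"


subsection \<open>The construction is a group with the universal property\<close>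

lemma inv_letter_invol [simp]: "inv_letter (inv_letter x) = x"
  by (simp add: inv_letter_def)

lemma inv_letter_neq [simp]: "inv_letter x \<noteq> x" "x \<noteq> inv_letter x"
  by (auto simp: inv_letter_def prod_eq_iff)

lemma fst_inv_letter [simp]: "fst (inv_letter x) = fst x"
  by (simp add: inv_letter_def)

lemma reduced_Nil [simp]: "reduced []"
  by (simp add: reduced_def)

lemma reduced_Cons: "reduced (x # w) \<longleftrightarrow> (w = [] \<or> hd w \<noteq> inv_letter x) \<and> reduced w"
  by (auto simp: reduced_def successively_Cons)

lemma reduced_push: "reduced w \<Longrightarrow> reduced (push_letter x w)"
  by (cases w) (auto simp: reduced_Cons)

lemma push_inv: "reduced w \<Longrightarrow> push_letter x (push_letter (inv_letter x) w) = w"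
proof (cases w)
  case (Cons y v)
  assume "reduced w"
  with Cons show ?thesis by (cases v) (auto simp: reduced_Cons)
qed simp

lemma reduced_foldr_push: "reduced v \<Longrightarrow> reduced (foldr push_letter u v)"
  by (induction u) (auto intro: reduced_push)

lemma push_lists: "fst x \<in> S \<Longrightarrow> w \<in> lists (S \<times> UNIV) \<Longrightarrow> push_letter x w \<in> lists (S \<times> UNIV)"
  by (cases w; cases x) auto

lemma foldr_push_lists:
  "u \<in> lists (S \<times> UNIV) \<Longrightarrow> v \<in> lists (S \<times> UNIV) \<Longrightarrow> foldr push_letter u v \<in> lists (S \<times> UNIV)"
proof (induction u)
  case (Cons x u)
  then show ?case using push_lists[of x S "foldr push_letter u v"] by (cases x) auto
qed simp

lemma foldr_push_push:
  "reduced v \<Longrightarrow> foldr push_letter (push_letter x u) v = push_letter x (foldr push_letter u v)"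
  by (cases u) (auto simp: push_inv reduced_foldr_push)

lemma foldr_push_assoc:
  "reduced w \<Longrightarrow>
     foldr push_letter (foldr push_letter u v) w = foldr push_letter u (foldr push_letter v w)"
  by (induction u) (auto simp: foldr_push_push)

lemma foldr_push_reduced: "reduced w \<Longrightarrow> foldr push_letter w [] = w"
proof (induction w)
  case (Cons x w)
  then show ?case by (cases w) (auto simp: reduced_Cons)
qed simp

lemma foldr_push_inverse:
  "reduced v \<Longrightarrow> foldr push_letter (rev (map inv_letter w)) (foldr push_letter w v) = v"
proof (induction w arbitrary: v)
  case (Cons x w)
  have "push_letter (inv_letter x) (push_letter x (foldr push_letter w v)) = foldr push_letter w v"
    using push_inv[of "foldr push_letter w v" "inv_letter x"] Cons.prems
    by (simp add: reduced_foldr_push)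
  with Cons show ?case by simp
qed simp

lemma reduced_rev_inv: "reduced w \<Longrightarrow> reduced (rev (map inv_letter w))"
  unfolding reduced_def successively_rev successively_map
  by (rule successively_mono[where P = "\<lambda>x y. y \<noteq> inv_letter x"]) auto

lemma rev_inv_carrier:
  assumes "w \<in> carrier (free_group S)"
  shows "rev (map inv_letter w) \<in> carrier (free_group S)"
proof -
  have "fst x \<in> S" if "x \<in> set w" for x
    using assms that by (auto simp: free_group_def)
  then have "rev (map inv_letter w) \<in> lists (S \<times> UNIV)"
    by (auto simp: in_lists_conv_set mem_Times_iff)
  moreover have "reduced w" using assms by (simp add: free_group_def)
  ultimately show ?thesis using reduced_rev_inv by (simp add: free_group_def)
qed

theorem group_free_group: "group (free_group S)"
proof (rule groupI)
  fix w assume w: "w \<in> carrier (free_group S)"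
  let ?v = "rev (map inv_letter w)"
  have "?v \<in> carrier (free_group S)"
    by (rule rev_inv_carrier) (rule w)
  moreover have "foldr push_letter ?v w = []"
    using foldr_push_inverse[of "[]" w] w foldr_push_reduced[of w]
    by (simp add: free_group_def)
  ultimately show "\<exists>v \<in> carrier (free_group S). v \<otimes>\<^bsub>free_group S\<^esub> w = \<one>\<^bsub>free_group S\<^esub>"
    by (intro bexI[of _ ?v]) (auto simp: free_group_def)
next
  fix u v assume "u \<in> carrier (free_group S)" "v \<in> carrier (free_group S)"
  then show "u \<otimes>\<^bsub>free_group S\<^esub> v \<in> carrier (free_group S)"
    using foldr_push_lists[of u S v] by (simp add: free_group_def reduced_foldr_push)
qed (auto simp: free_group_def foldr_push_assoc)

lemma inv_free_group:
  assumes "w \<in> carrier (free_group S)"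
  shows "inv\<^bsub>free_group S\<^esub> w = rev (map inv_letter w)"
proof -
  interpret group "free_group S" by (rule group_free_group)
  have "rev (map inv_letter w) \<in> carrier (free_group S)"
    by (rule rev_inv_carrier) (rule assms)
  moreover have "rev (map inv_letter w) \<otimes>\<^bsub>free_group S\<^esub> w = \<one>\<^bsub>free_group S\<^esub>"
    using foldr_push_inverse[of "[]" w] assms foldr_push_reduced[of w]
    by (simp add: free_group_def)
  ultimately show ?thesis using assms by (metis inv_equality)
qed

lemma free_basis_subset: "free_basis S \<subseteq> carrier (free_group S)"
  by (auto simp: free_basis_def free_group_def reduced_def)

lemma generate_free_basis: "generate (free_group S) (free_basis S) = carrier (free_group S)"
proof
  interpret group "free_group S" by (rule group_free_group)
  show "generate (free_group S) (free_basis S) \<subseteq> carrier (free_group S)"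
    by (rule generate_incl) (rule free_basis_subset)
  have "w \<in> generate (free_group S) (free_basis S)"
    if "w \<in> lists (S \<times> UNIV)" "reduced w" for w
    using that
  proof (induction w)
    case Nil
    then show ?case using generate.one[of "free_group S"] by (simp add: free_group_def)
  next
    case (Cons x w)
    obtain s e where x: "x = (s, e)" by (cases x)
    have s: "[(s, True)] \<in> free_basis S"
    proof -
      have "s \<in> S" using Cons x by auto
      then show ?thesis unfolding free_basis_def by (rule imageI)
    qed
    have "[x] \<in> generate (free_group S) (free_basis S)"
    proof (cases e)
      case True
      then show ?thesis using s x by (auto intro: generate.incl)
    next
      case False
      have "inv\<^bsub>free_group S\<^esub> [(s, True)] = [x]"
        using s free_basis_subset x False by (subst inv_free_group) (auto simp: inv_letter_def)
      then show ?thesis using generate.inv[OF s, of "free_group S"] by simp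
    qed
    moreover have "w \<in> generate (free_group S) (free_basis S)"
      using Cons by (auto simp: reduced_Cons)
    moreover have "[x] \<otimes>\<^bsub>free_group S\<^esub> w = x # w"
      using Cons.prems by (cases w) (auto simp: free_group_def reduced_Cons)
    ultimately show ?case using generate.eng by metis
  qed
  then show "carrier (free_group S) \<subseteq> generate (free_group S) (free_basis S)"
    by (auto simp: free_group_def)
qed

theorem free_group_universal:
  assumes H: "group H" and f: "f \<in> S \<rightarrow> carrier H"
  shows "\<exists>\<phi> \<in> hom (free_group S) H. (\<forall>s \<in> S. \<phi> [(s, True)] = f s) \<and>
           (\<forall>\<psi> \<in> hom (free_group S) H. (\<forall>s \<in> S. \<psi> [(s, True)] = f s) \<longrightarrow>
              (\<forall>w \<in> carrier (free_group S). \<psi> w = \<phi> w))"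
proof -
  interpret H: group H by (rule H)
  define l where "l x = (if snd x then f (fst x) else inv\<^bsub>H\<^esub> f (fst x))" for x
  define \<phi> where "\<phi> w = foldr (\<lambda>x y. l x \<otimes>\<^bsub>H\<^esub> y) w \<one>\<^bsub>H\<^esub>" for w
  have l: "l x \<in> carrier H" if "fst x \<in> S" for x
    using that f by (auto simp: l_def)
  have l_inv: "l (inv_letter x) = inv\<^bsub>H\<^esub> l x" if "fst x \<in> S" for x
    using that f by (auto simp: l_def inv_letter_def Pi_iff)
  have \<phi>: "\<phi> w \<in> carrier H" if "w \<in> lists (S \<times> UNIV)" for w
    using that by (induction w) (auto simp: \<phi>_def l)
  have push: "\<phi> (push_letter x w) = l x \<otimes>\<^bsub>H\<^esub> \<phi> w"
    if "fst x \<in> S" "w \<in> lists (S \<times> UNIV)" for x w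
  proof (cases w)
    case (Cons y v)
    have v: "\<phi> v \<in> carrier H" using \<phi> that Cons by auto
    have "l x \<otimes>\<^bsub>H\<^esub> (inv\<^bsub>H\<^esub> l x \<otimes>\<^bsub>H\<^esub> \<phi> v) = \<phi> v"
      using l[OF that(1)] v by (simp flip: H.m_assoc)
    then show ?thesis using Cons that by (simp add: \<phi>_def l_inv)
  qed (simp add: \<phi>_def)
  have mult: "\<phi> (foldr push_letter u v) = \<phi> u \<otimes>\<^bsub>H\<^esub> \<phi> v"
    if "u \<in> lists (S \<times> UNIV)" "v \<in> lists (S \<times> UNIV)" for u v
    using that(1)
  proof (induction u)
    case Nil
    then show ?case using \<phi>[OF that(2)] by (simp add: \<phi>_def)
  next
    case (Cons x u)
    have "\<phi> (x # u) = l x \<otimes>\<^bsub>H\<^esub> \<phi> u" by (simp add: \<phi>_def)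
    moreover have "fst x \<in> S" using Cons by auto
    moreover have "\<phi> u \<in> carrier H" "\<phi> v \<in> carrier H" using \<phi> Cons that by auto
    ultimately show ?case
      using Cons that by (simp add: push foldr_push_lists l H.m_assoc)
  qed
  have \<phi>_hom: "\<phi> \<in> hom (free_group S) H"
    using \<phi> mult by (auto simp: hom_def free_group_def)
  moreover have \<phi>_gen: "\<phi> [(s, True)] = f s" if "s \<in> S" for s
    using that f by (auto simp: \<phi>_def l_def Pi_iff)
  moreover have "\<psi> w = \<phi> w"
    if \<psi>: "\<psi> \<in> hom (free_group S) H" and gen: "\<forall>s \<in> S. \<psi> [(s, True)] = f s"
      and w: "w \<in> carrier (free_group S)" for \<psi> w
  proof -
    interpret A: group_hom "free_group S" H \<phi>
      using \<phi>_hom group_free_group H by (simp add: group_hom_def group_hom_axioms_def)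
    interpret B: group_hom "free_group S" H \<psi>
      using \<psi> group_free_group H by (simp add: group_hom_def group_hom_axioms_def)
    have "w \<in> generate (free_group S) (free_basis S)"
      using w by (simp add: generate_free_basis)
    then show ?thesis
    proof induction
      case (incl h)
      then show ?case using gen \<phi>_gen by (auto simp: free_basis_def)
    next
      case (inv h)
      moreover have "\<psi> h = \<phi> h" using inv gen \<phi>_gen by (auto simp: free_basis_def)
      ultimately show ?case using free_basis_subset by (metis A.hom_inv B.hom_inv subsetD)
    next
      case (eng g h)
      then show ?case by (simp add: generate_free_basis)
    qed simp
  qed
  ultimately show ?thesis by blast
qed


section \<open>The conjugacy growth function counts a finite set\<close>

text \<open>This justifies the use of \<^const>\<open>card\<close>, which is \<open>0\<close> on infinite sets.\<close>

lemma (in group) word_eval_append: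
  assumes "set u \<subseteq> carrier G" "set v \<subseteq> carrier G"
  shows "word_eval G (u @ v) = word_eval G u \<otimes> word_eval G v"
proof -
  have cl: "word_eval G w \<in> carrier G" if "set w \<subseteq> carrier G" for w
    using that by (induction w) (auto simp: word_eval_def)
  show ?thesis
    using assms(1)
  proof (induction u)
    case Nil
    then show ?case using cl[OF assms(2)] by (simp add: word_eval_def)
  next
    case (Cons x u)
    then show ?case using cl[of u] cl[OF assms(2)] by (simp add: word_eval_def m_assoc)
  qed
qed

lemma (in group) word_eval_surj:
  assumes X: "X \<subseteq> carrier G" and g: "g \<in> generate G X"
  shows "\<exists>w \<in> lists (sym_gens G X). word_eval G w = g"
  using g
proof induction
  case one
  then show ?case by (intro bexI[of _ "[]"]) (auto simp: word_eval_def)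
next
  case (incl h)
  then show ?case using X
    by (intro bexI[of _ "[h]"]) (auto simp: word_eval_def sym_gens_def)
next
  case (inv h)
  then show ?case using X
    by (intro bexI[of _ "[inv h]"]) (auto simp: word_eval_def sym_gens_def)
next
  case (eng g h)
  then obtain u v where "u \<in> lists (sym_gens G X)" "word_eval G u = g"
    "v \<in> lists (sym_gens G X)" "word_eval G v = h" by blast
  moreover have "sym_gens G X \<subseteq> carrier G" using X by (auto simp: sym_gens_def)
  ultimately show ?case
    by (intro bexI[of _ "u @ v"]) (auto simp: word_eval_append in_lists_conv_set subset_iff)
qed

lemma (in group) conj_class_conj:
  assumes g: "g \<in> carrier G" and h: "h \<in> conj_class G g"
  shows "conj_class G h = conj_class G g"
proof -
  from h obtain k where k: "k \<in> carrier G" "h = k \<otimes> g \<otimes> inv k"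
    by (auto simp: conj_class_def)
  have "x \<otimes> h \<otimes> inv x = (x \<otimes> k) \<otimes> g \<otimes> inv (x \<otimes> k)" if "x \<in> carrier G" for x
    using that k g by (simp add: inv_mult_group m_assoc)
  then have 1: "conj_class G h \<subseteq> conj_class G g"
    unfolding conj_class_def using k(1) by (blast intro: m_closed)
  have "y \<otimes> g \<otimes> inv y = (y \<otimes> inv k) \<otimes> h \<otimes> inv (y \<otimes> inv k)" if "y \<in> carrier G" for y
  proof -
    have "inv k \<otimes> (k \<otimes> (g \<otimes> z)) = g \<otimes> z" if "z \<in> carrier G" for z
      using that k g by (simp flip: m_assoc)
    moreover have "inv k \<otimes> (k \<otimes> inv y) = inv y"
      using k that by (simp flip: m_assoc)
    ultimately show ?thesis
      using that k g by (simp add: inv_mult_group m_assoc)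
  qed
  then have "conj_class G g \<subseteq> conj_class G h"
    unfolding conj_class_def using k(1) by (blast intro: m_closed inv_closed)
  with 1 show ?thesis by blast
qed

lemma (in group) finite_conj_growth_set:
  assumes X: "X \<subseteq> carrier G" "finite X" "generate G X = carrier G"
  shows "finite {conj_class G g | g.
           g \<in> carrier G \<and> conj_length G X g = n \<and> conj_class G g \<inter> U \<noteq> {}}"
proof (rule finite_subset)
  let ?W = "{w. set w \<subseteq> sym_gens G X \<and> length w = n}"
  show "finite ((\<lambda>w. conj_class G (word_eval G w)) ` ?W)"
    using X by (intro finite_imageI finite_lists_length_eq) (auto simp: sym_gens_def)
  show "{conj_class G g | g.
           g \<in> carrier G \<and> conj_length G X g = n \<and> conj_class G g \<inter> U \<noteq> {}}
        \<subseteq> (\<lambda>w. conj_class G (word_eval G w)) ` ?W"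
  proof clarify
    fix g assume g: "g \<in> carrier G" and n: "n = conj_length G X g"
    have ne: "\<exists>m. \<exists>h \<in> conj_class G g. word_length G X h = m"
      using g by (auto simp: conj_class_def)
    obtain h where h: "h \<in> conj_class G g" "word_length G X h = n"
      using LeastI_ex[OF ne] by (auto simp: n conj_length_def)
    have "h \<in> generate G X" using h(1) g X by (auto simp: conj_class_def)
    then have ne': "\<exists>m. \<exists>w \<in> lists (sym_gens G X). word_eval G w = h \<and> length w = m"
      using word_eval_surj[OF X(1)] by blast
    obtain w where "w \<in> lists (sym_gens G X)" "word_eval G w = h" "length w = n"
      using LeastI_ex[OF ne'] h(2) by (auto simp: word_length_def)
    then show "conj_class G g \<in> (\<lambda>w. conj_class G (word_eval G w)) `
        {w. set w \<subseteq> sym_gens G X \<and> length w = conj_length G X g}"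
      using conj_class_conj[OF g h(1)] n by (auto simp: in_lists_conv_set intro!: image_eqI[of _ _ w])
  qed
qed

end

theory Submission
  imports Defs "HOL-Real_Asymp.Real_Asymp"
begin

text \<open>Every element of a free group is \<open>p c p\<inverse>\<close> without cancellation for a cyclically reduced \<open>c\<close>,
  and two cyclically reduced words are conjugate only if one is a rotation of the other. Hence, up to
  a factor \<open>n\<close>, the relative conjugacy growth of \<open>U\<close> counts the words of length \<open>n\<close> in the language of
  cyclically reduced cores of elements of \<open>U\<close>. For rational \<open>U\<close> this language is regular, in the form
  of having finitely many residuals. If some nonempty residual is fixed by two distinct words of the same
  length, these generate exponentially many words; otherwise there is at most one loop of each length at
  each state, and removing the states one at a time gives a polynomial bound.

  Polynomial growth of degree \<open>e = d - 1\<close> is realised by the words \<open>w b a\<inverse> b\<close> with \<open>w\<close> a positive word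
  having exactly \<open>e\<close> letters \<open>b\<close>: the unique \<open>a\<inverse>\<close> forbids nontrivial rotations, so there are
  \<open>n - 3 choose e\<close> classes of length \<open>n\<close>.\<close>

section \<open>Free reduction and cyclic words\<close>

text \<open>The fold of the group product, applied to an arbitrary word and the neutral element, so
  that evaluating a word of generators is literally \<open>free_red\<close>.\<close>

definition free_red :: "('s \<times> bool) list \<Rightarrow> ('s \<times> bool) list" where
  "free_red w = foldr push_letter w []"

definition word_inv :: "('s \<times> bool) list \<Rightarrow> ('s \<times> bool) list" where
  "word_inv w = rev (map inv_letter w)"

text \<open>Reducedness of the square tests the inner pairs of letters and the wrap-around pair at
  once; the empty word passes.\<close>

definition cyc_reduced :: "('s \<times> bool) list \<Rightarrow> bool" where
  "cyc_reduced c \<longleftrightarrow> reduced (c @ c)"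

lemma free_red_simps [simp]:
  "free_red [] = []" "free_red (x # w) = push_letter x (free_red w)"
  by (simp_all add: free_red_def)

lemma reduced_free_red [simp]: "reduced (free_red w)"
  by (simp add: free_red_def reduced_foldr_push)

lemma free_red_reduced: "reduced w \<Longrightarrow> free_red w = w"
  by (simp add: free_red_def foldr_push_reduced)

lemma free_red_idem [simp]: "free_red (free_red w) = free_red w"
  by (simp add: free_red_reduced)

lemma free_red_append: "free_red (u @ v) = foldr push_letter u (free_red v)"
  by (simp add: free_red_def)

lemma free_red_append_left [simp]: "free_red (free_red u @ v) = free_red (u @ v)"
  using foldr_push_assoc[of "free_red v" u "[]"]
  by (simp add: free_red_append) (simp add: free_red_def)

lemma free_red_append_right [simp]: "free_red (u @ free_red v) = free_red (u @ v)"
  by (simp add: free_red_append free_red_reduced)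

lemma free_red_lists: "w \<in> lists (S \<times> UNIV) \<Longrightarrow> free_red w \<in> lists (S \<times> UNIV)"
  unfolding free_red_def by (rule foldr_push_lists) auto

lemma length_free_red: "length (free_red w) \<le> length w"
proof (induction w)
  case (Cons x w)
  have "length (push_letter x v) \<le> Suc (length v)" for v
    by (cases v) auto
  with Cons show ?case by (metis Suc_le_mono free_red_simps(2) le_trans length_Cons)
qed simp

text \<open>A word spells a path in the Cayley tree, which must pass through every vertex of the geodesic
  between its endpoints.\<close>

lemma free_red_split:
  assumes "free_red w = g @ h"
  shows "\<exists>u v. w = u @ v \<and> free_red u = g \<and> free_red v = h"
  using assms
proof (induction w arbitrary: g h)
  case (Cons y w)
  show ?case
  proof (cases g)
    case Nil
    then show ?thesis using Cons.prems
      by (intro exI[of _ "[]"] exI[of _ "y # w"]) simp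
  next
    case g: (Cons x g')
    show ?thesis
    proof (cases "\<exists>v. free_red w = inv_letter y # v")
      case True
      \<comment> \<open>The letter \<open>y\<close> cancels, so \<open>w\<close> is cut at the
        vertex \<open>inv_letter y # g\<close>, which \<open>y\<close> carries to
        \<open>g\<close>.\<close>
      then have "free_red w = (inv_letter y # g) @ h" using Cons.prems by auto
      with Cons.IH obtain u v where uv: "w = u @ v" "free_red u = inv_letter y # g" "free_red v = h"
        by metis
      then show ?thesis
        by (intro exI[of _ "y # u"] exI[of _ v]) simp
    next
      case False
      \<comment> \<open>Without cancellation \<open>y\<close> is the first letter of
        \<open>g\<close>, and the rest of \<open>g\<close> is a prefix of
        \<open>free_red w\<close>.\<close>
      then have "free_red (y # w) = y # free_red w"
        by (cases "free_red w") auto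
      then have "free_red w = g' @ h" "x = y" using Cons.prems g by auto
      with Cons.IH obtain u v where uv: "w = u @ v" "free_red u = g'" "free_red v = h" by metis
      have "reduced (free_red (y # w))" by (rule reduced_free_red)
      then have "reduced ((y # g') @ h)" using Cons.prems g \<open>x = y\<close> by simp
      then have "reduced (y # g')" unfolding reduced_def successively_append_iff by blast
      then have "push_letter y g' = y # g'" by (cases g') (auto simp: reduced_Cons)
      then show ?thesis using uv g \<open>x = y\<close>
        by (intro exI[of _ "y # u"] exI[of _ v]) simp
    qed
  qed
qed simp

section \<open>Inverse words and cyclic reducedness\<close>

lemma reduced_append:
  "reduced (u @ v) \<longleftrightarrow>
     reduced u \<and> reduced v \<and> (u = [] \<or> v = [] \<or> hd v \<noteq> inv_letter (last u))"
  unfolding reduced_def successively_append_iff by auto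

lemma word_inv_simps [simp]:
  "word_inv [] = []" "word_inv (x # w) = word_inv w @ [inv_letter x]"
  "word_inv (u @ v) = word_inv v @ word_inv u" "length (word_inv w) = length w"
  by (simp_all add: word_inv_def)

lemma word_inv_lists: "w \<in> lists (S \<times> UNIV) \<Longrightarrow> word_inv w \<in> lists (S \<times> UNIV)"
  by (auto simp: word_inv_def inv_letter_def in_lists_conv_set)

lemma inv_letter_eq_iff [simp]: "inv_letter x = inv_letter y \<longleftrightarrow> x = y"
  by (metis inv_letter_invol)

lemma cyc_reduced_reduced: "cyc_reduced c \<Longrightarrow> reduced c"
  by (simp add: cyc_reduced_def reduced_append)

lemma cyc_reduced_iff:
  "cyc_reduced c \<longleftrightarrow> reduced c \<and> (c = [] \<or> hd c \<noteq> inv_letter (last c))"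
  by (auto simp: cyc_reduced_def reduced_append)

text \<open>One rotation step turns the wrap-around pair into an inner pair and the first inner pair
  into the wrap-around pair.\<close>

lemma cyc_reduced_rotate: "cyc_reduced c \<Longrightarrow> cyc_reduced (rotate m c)"
proof (induction m)
  case (Suc m)
  then show ?case
    by (cases "rotate m c") (auto simp: cyc_reduced_iff reduced_append reduced_Cons split: if_splits)
qed simp

text \<open>The shape "\<open>p\<close>, rotated core, inverse of \<open>p\<close>" survives
  conjugation by one letter \<open>x\<close>: if \<open>p\<close> is nonempty, it gains or loses its
  first letter; if \<open>p\<close> is empty, the core is rotated by one step or \<open>x\<close>
  becomes the new \<open>p\<close>.\<close>

lemma conj_cyc_reduced:
  assumes "cyc_reduced c"
  shows "\<exists>p m. free_red (w @ c @ word_inv w) = p @ rotate m c @ word_inv p"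
proof (induction w)
  case Nil
  show ?case using assms
    by (intro exI[of _ "[]"] exI[of _ 0]) (simp add: free_red_reduced cyc_reduced_reduced)
next
  case (Cons x w)
  then obtain p m where pm: "free_red (w @ c @ word_inv w) = p @ rotate m c @ word_inv p"
    by blast
  let ?r = "rotate m c"
  have r: "cyc_reduced ?r" using assms by (rule cyc_reduced_rotate)
  have "free_red ((x # w) @ c @ word_inv (x # w))
      = free_red ([x] @ free_red (free_red (w @ c @ word_inv w) @ [inv_letter x]))"
    unfolding free_red_append_left free_red_append_right by simp
  then have eq: "free_red ((x # w) @ c @ word_inv (x # w))
      = free_red (x # p @ ?r @ word_inv p @ [inv_letter x])"
    by (simp add: pm)
  have red: "reduced (p @ ?r @ word_inv p)" by (metis pm reduced_free_red)
  show ?case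
  proof (cases p)
    case (Cons y q)
    show ?thesis
    proof (cases "y = inv_letter x")
      case True
      then have "p @ ?r @ word_inv p @ [inv_letter x]
          = (inv_letter x # q @ ?r @ word_inv q) @ [x, inv_letter x]" using Cons by simp
      moreover have "free_red [x, inv_letter x] = []" by simp
      ultimately have "free_red (p @ ?r @ word_inv p @ [inv_letter x])
          = free_red (inv_letter x # q @ ?r @ word_inv q)"
        by (metis append_Nil2 free_red_append_right)
      moreover have "reduced (inv_letter x # q @ ?r @ word_inv q)"
      proof -
        have "reduced ((inv_letter x # q @ ?r @ word_inv q) @ [x])" using red Cons True by simp
        then show ?thesis unfolding reduced_append by blast
      qed
      ultimately have "free_red (p @ ?r @ word_inv p @ [inv_letter x])
          = inv_letter x # q @ ?r @ word_inv q"
        by (simp add: free_red_reduced del: free_red_simps)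
      then show ?thesis using eq by auto
    next
      case False
      let ?h = "p @ ?r @ word_inv p"
      \<comment> \<open>The ends of \<open>?h\<close> are mutually inverse, so \<open>x\<close>
        cancels on the left exactly when \<open>inv_letter x\<close> cancels on the right.\<close>
      have "?h \<noteq> []" "hd ?h = y" "last ?h = inv_letter y" using Cons by simp_all
      then have "reduced (x # ?h @ [inv_letter x])"
        using False red unfolding reduced_Cons reduced_append
        by (metis append_is_Nil_conv hd_append2 inv_letter_invol list.sel(1) reduced_Cons reduced_Nil)
      then have "free_red (x # ?h @ [inv_letter x]) = (x # p) @ ?r @ word_inv (x # p)"
        by (simp add: free_red_reduced del: free_red_simps)
      then show ?thesis using eq by (metis append_assoc)
    qed
  next
    case Nil
    show ?thesis
    proof (cases "?r = []")
      case True
      then show ?thesis using eq Nil by (intro exI[of _ "[]"] exI[of _ m]) simp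
    next
      case ne: False
      consider "hd ?r = inv_letter x" | "last ?r = x"
        | "hd ?r \<noteq> inv_letter x" "last ?r \<noteq> x" by blast
      then show ?thesis
      proof cases
        case 1
        \<comment> \<open>\<open>x\<close> removes the first letter of the rotated core and
          \<open>inv_letter x\<close> restores it at the end: one more rotation.\<close>
        then obtain d where d: "?r = inv_letter x # d" using ne by (cases ?r) auto
        then have "rotate (Suc m) c = d @ [inv_letter x]" by simp
        moreover have "reduced (?r @ [inv_letter x])"
          using r d unfolding reduced_append cyc_reduced_iff by (auto simp: reduced_Cons)
        then have "free_red (?r @ [inv_letter x]) = inv_letter x # d @ [inv_letter x]"
          unfolding d by (metis append_Cons free_red_reduced)
        then have "free_red (x # ?r @ [inv_letter x]) = d @ [inv_letter x]"
          by (simp only: free_red_simps) simp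
        ultimately show ?thesis using eq Nil
          by (intro exI[of _ "[]"] exI[of _ "Suc m"]) simp
      next
        case 2
        then obtain d where d: "?r = d @ [x]" using ne by (metis append_butlast_last_id)
        \<comment> \<open>Here the last letter cancels and reappears in front, a backward rotation
          expressed by \<open>length d\<close> forward ones.\<close>
        have rot: "rotate (length d + m) c = x # d"
          using d by (metis append_Cons append_Nil rotate_append rotate_rotate)
        have "cyc_reduced (rotate (length d + m) c)" using assms by (rule cyc_reduced_rotate)
        then have "reduced (x # d)" using rot by (simp add: cyc_reduced_reduced)
        moreover have "free_red (x # ?r @ [inv_letter x]) = free_red ((x # d) @ free_red [x, inv_letter x])"
          unfolding free_red_append_right using d by simp
        moreover have "free_red [x, inv_letter x] = []" by simp
        ultimately have "free_red (x # ?r @ [inv_letter x]) = x # d"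
          by (metis append_Nil2 free_red_reduced)
        then show ?thesis using eq Nil rot
          by (intro exI[of _ "[]"] exI[of _ "length d + m"]) simp
      next
        case 3
        have "reduced (x # ?r @ [inv_letter x])"
          using 3 r ne by (auto simp: reduced_Cons reduced_append cyc_reduced_iff)
        then show ?thesis using eq Nil
          by (intro exI[of _ "[x]"] exI[of _ m]) (simp add: free_red_reduced del: free_red_simps)
      qed
    qed
  qed
qed

text \<open>A reduced word that is not cyclically reduced has mutually inverse end letters; peeling
  them off shortens the word and contributes a letter to \<open>p\<close>.\<close>

lemma reduced_decomp:
  assumes "reduced h"
  shows "\<exists>p c. h = p @ c @ word_inv p \<and> cyc_reduced c"
  using assms
proof (induction h rule: length_induct)
  case (1 h)
  show ?case
  proof (cases "cyc_reduced h")
    case True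
    then show ?thesis by (intro exI[of _ "[]"] exI[of _ h]) simp
  next
    case False
    then have h: "h \<noteq> []" "hd h = inv_letter (last h)"
      using 1(2) by (auto simp: cyc_reduced_iff)
    then obtain x t where t: "h = x # t" by (cases h) auto
    with h have "t \<noteq> []" by auto
    then obtain m where m: "h = x # m @ [inv_letter x]"
      using t h by (metis append_butlast_last_id inv_letter_invol last_ConsR list.sel(1))
    then have "reduced m" using 1(2) by (auto simp: reduced_Cons reduced_append)
    then obtain p c where "m = p @ c @ word_inv p" "cyc_reduced c"
      using 1(1) m by (metis add_diff_cancel_left' length_Cons length_append_singleton lessI less_SucI)
    then show ?thesis using m by (intro exI[of _ "x # p"] exI[of _ c]) simp
  qed
qed

section \<open>Conjugacy classes in the free group\<close>

lemma carrier_free_group [simp]: "w \<in> carrier (free_group S) \<longleftrightarrow> w \<in> lists (S \<times> UNIV) \<and> reduced w"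
  by (simp add: free_group_def)

lemma mult_free_group: "reduced v \<Longrightarrow> u \<otimes>\<^bsub>free_group S\<^esub> v = free_red (u @ v)"
  by (simp add: free_group_def free_red_append free_red_reduced)

lemma reduced_word_inv: "reduced w \<Longrightarrow> reduced (word_inv w)"
  unfolding word_inv_def by (rule reduced_rev_inv)

text \<open>The generators are one-letter words, so a word over them is a list of singleton lists;
  \<open>map (\<lambda>x. [x])\<close> translates from plain lists of letters.\<close>

lemma sym_gens_free_group:
  "sym_gens (free_group S) (free_basis S) = (\<lambda>x. [x]) ` (S \<times> UNIV)"
proof -
  have "inv\<^bsub>free_group S\<^esub> [(s, True)] = [(s, False)]" if "s \<in> S" for s
    using that by (subst inv_free_group) (auto simp: inv_letter_def reduced_def)
  then have "sym_gens (free_group S) (free_basis S)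
      = (\<lambda>s. [(s, True)]) ` S \<union> (\<lambda>s. [(s, False)]) ` S"
    unfolding sym_gens_def free_basis_def by (auto simp: image_iff)
  also have "\<dots> = (\<lambda>x. [x]) ` (S \<times> UNIV)"
    by (auto simp: image_iff)
  finally show ?thesis .
qed

lemma lists_sym_gens_free_group:
  "lists (sym_gens (free_group S) (free_basis S)) = map (\<lambda>x. [x]) ` lists (S \<times> UNIV)"
  unfolding sym_gens_free_group by (rule lists_image)

lemma word_eval_free_group: "word_eval (free_group S) (map (\<lambda>x. [x]) w) = free_red w"
  by (induction w) (simp_all add: word_eval_def free_group_def)

text \<open>Free reduction never lengthens a word, so no word evaluating to a reduced word is
  shorter than it.\<close>

lemma word_length_free_group:
  assumes "w \<in> carrier (free_group S)"
  shows "word_length (free_group S) (free_basis S) w = length w"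
  unfolding word_length_def lists_sym_gens_free_group
proof (rule Least_equality)
  show "\<exists>v \<in> map (\<lambda>x. [x]) ` lists (S \<times> UNIV). word_eval (free_group S) v = w \<and> length v = length w"
    using assms
    by (intro bexI[of _ "map (\<lambda>x. [x]) w"]) (auto simp: word_eval_free_group free_red_reduced)
next
  fix n assume "\<exists>v \<in> map (\<lambda>x. [x]) ` lists (S \<times> UNIV). word_eval (free_group S) v = w \<and> length v = n"
  then obtain v where "free_red v = w" "length v = n"
    by (auto simp only: word_eval_free_group length_map)
  then show "length w \<le> n" using length_free_red by blast
qed

lemma conj_class_free_group:
  assumes "g \<in> carrier (free_group S)"
  shows "conj_class (free_group S) g = {free_red (h @ g @ word_inv h) | h. h \<in> carrier (free_group S)}"
proof -
  have "h \<otimes>\<^bsub>free_group S\<^esub> g \<otimes>\<^bsub>free_group S\<^esub> inv\<^bsub>free_group S\<^esub> h = free_red (h @ g @ word_inv h)"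
    if "h \<in> carrier (free_group S)" for h
    using that assms
    by (simp add: mult_free_group inv_free_group reduced_word_inv flip: word_inv_def)
  then show ?thesis unfolding conj_class_def by (intro Collect_cong) metis
qed

lemma conj_class_cyc_reduced:
  assumes "c \<in> lists (S \<times> UNIV)" "cyc_reduced c" "h \<in> conj_class (free_group S) c"
  shows "\<exists>p m. h = p @ rotate m c @ word_inv p"
  using assms conj_cyc_reduced by (auto simp: conj_class_free_group cyc_reduced_reduced)

lemma conj_class_self:
  assumes "g \<in> carrier (free_group S)"
  shows "g \<in> conj_class (free_group S) g"
proof -
  have "g = free_red ([] @ g @ word_inv [])" "[] \<in> carrier (free_group S)"
    using assms by (simp_all add: free_red_reduced)
  then show ?thesis unfolding conj_class_free_group[OF assms] by blast
qed

lemma conj_class_eqI: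
  assumes "g \<in> carrier (free_group S)" "w \<in> carrier (free_group S)" "h = free_red (w @ g @ word_inv w)"
  shows "conj_class (free_group S) h = conj_class (free_group S) g"
proof -
  have "h \<in> conj_class (free_group S) g"
    using assms(2,3) unfolding conj_class_free_group[OF assms(1)] by blast
  then show ?thesis using group.conj_class_conj[OF group_free_group assms(1)] by blast
qed

text \<open>Every conjugate contains a rotation of \<open>c\<close> as a factor and is therefore at
  least as long as \<open>c\<close>.\<close>

lemma conj_length_cyc_reduced:
  assumes "c \<in> lists (S \<times> UNIV)" "cyc_reduced c"
  shows "conj_length (free_group S) (free_basis S) c = length c"
  unfolding conj_length_def
proof (rule Least_equality)
  have c: "c \<in> carrier (free_group S)" using assms by (simp add: cyc_reduced_reduced)
  show "\<exists>h \<in> conj_class (free_group S) c. word_length (free_group S) (free_basis S) h = length c"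
    using conj_class_self[OF c] word_length_free_group[OF c] by blast
  fix n assume "\<exists>h \<in> conj_class (free_group S) c. word_length (free_group S) (free_basis S) h = n"
  then obtain h where h: "h \<in> conj_class (free_group S) c"
    "word_length (free_group S) (free_basis S) h = n" by blast
  then obtain p m where "h = p @ rotate m c @ word_inv p"
    using conj_class_cyc_reduced[OF assms] by blast
  moreover have "h \<in> carrier (free_group S)"
  proof -
    obtain w where w: "w \<in> carrier (free_group S)" "h = free_red (w @ c @ word_inv w)"
      using h(1) unfolding conj_class_free_group[OF c] by blast
    then have "w @ c @ word_inv w \<in> lists (S \<times> UNIV)"
      using assms(1) word_inv_lists[of w S] by auto
    then show ?thesis using free_red_lists[of _ S] w(2) by (simp del: in_lists_conv_set append_in_lists_conv)
  qed
  ultimately have "length h = n" using h(2) word_length_free_group by metis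
  then show "length c \<le> n" using \<open>h = p @ rotate m c @ word_inv p\<close> by auto
qed

text \<open>A nonempty conjugating prefix \<open>p\<close> would give \<open>d\<close> mutually
  inverse end letters.\<close>

lemma conj_class_eq_imp_rotate:
  assumes c: "c \<in> lists (S \<times> UNIV)" "cyc_reduced c" and d: "d \<in> lists (S \<times> UNIV)" "cyc_reduced d"
    and eq: "conj_class (free_group S) c = conj_class (free_group S) d"
  shows "\<exists>m. d = rotate m c"
proof -
  have "d \<in> conj_class (free_group S) c"
    using conj_class_self[of d S] d eq by (simp add: cyc_reduced_reduced)
  then obtain p m where d_eq: "d = p @ rotate m c @ word_inv p"
    using conj_class_cyc_reduced[OF c] by blast
  have "p = []"
  proof (cases p)
    case (Cons x q)
    then have "hd d = x" "last d = inv_letter x" using d_eq by auto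
    then show ?thesis using d(2) Cons d_eq by (auto simp: cyc_reduced_iff)
  qed simp
  then show ?thesis using d_eq by auto
qed

text \<open>Both halves of the theorem are reduced to counting by this transfer: \<open>V\<close>
  supplies cyclically reduced representatives, whose length is the conjugacy length, of the classes
  meeting \<open>U\<close>. Several rotations of one word may lie in \<open>V\<close>, so classes
  are counted and not words.\<close>

lemma conj_growth_classes:
  assumes V: "V \<subseteq> {c \<in> lists (S \<times> UNIV). cyc_reduced c}"
    and VU: "\<And>c. c \<in> V \<Longrightarrow> conj_class (free_group S) c \<inter> U \<noteq> {}"
    and UV: "\<And>u. u \<in> U \<Longrightarrow> \<exists>c \<in> V. conj_class (free_group S) c = conj_class (free_group S) u"
  shows "conj_growth (free_group S) (free_basis S) U n
       = card (conj_class (free_group S) ` {c \<in> V. length c = n})"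
proof -
  let ?cc = "conj_class (free_group S)" and ?cl = "conj_length (free_group S) (free_basis S)"
  have "{?cc g | g. g \<in> carrier (free_group S) \<and> ?cl g = n \<and> ?cc g \<inter> U \<noteq> {}}
      = ?cc ` {c \<in> V. length c = n}" (is "?A = ?B")
  proof
    show "?A \<subseteq> ?B"
    proof
      fix K assume "K \<in> ?A"
      then obtain g u where K: "K = ?cc g" and g: "g \<in> carrier (free_group S)" "?cl g = n"
        and u: "u \<in> ?cc g" "u \<in> U" by blast
      obtain c where c: "c \<in> V" "?cc c = ?cc u" using UV u(2) by blast
      have eq: "?cc c = ?cc g" using c(2) group.conj_class_conj[OF group_free_group g(1) u(1)] by simp
      then have "?cl g = ?cl c" by (simp add: conj_length_def)
      then have "length c = n"
        using V c(1) g(2) conj_length_cyc_reduced[of c S] by (metis (lifting) mem_Collect_eq subsetD)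
      then show "K \<in> ?B" using c(1) eq K by blast
    qed
    show "?B \<subseteq> ?A"
    proof
      fix K assume "K \<in> ?B"
      then obtain c where c: "K = ?cc c" "c \<in> V" "length c = n" by blast
      then have "c \<in> lists (S \<times> UNIV)" "cyc_reduced c" using V by auto
      then have "?cl c = n" "c \<in> carrier (free_group S)"
        using c(3) by (simp_all add: conj_length_cyc_reduced cyc_reduced_reduced)
      then show "K \<in> ?A" using VU[OF c(2)] c(1) by blast
    qed
  qed
  then show ?thesis unfolding conj_growth_def by (rule arg_cong)
qed

section \<open>Growth of languages with finitely many residuals\<close>

text \<open>The left quotient of \<open>L\<close> by \<open>u\<close>. The residuals are the states
  of the minimal automaton, with \<open>{}\<close> as the dead state.\<close>

definition residual :: "'a list set \<Rightarrow> 'a list \<Rightarrow> 'a list set" where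
  "residual L u = {v. u @ v \<in> L}"

lemma residual_append: "residual L (u @ v) = residual (residual L u) v"
  by (simp add: residual_def)

text \<open>With residuals as states, the words counted label paths of length \<open>n\<close> from
  \<open>residual L s\<close> that stay in \<open>Q\<close>. A path is cut at its last visit to its
  start: the loop before the cut is fixed by its length, and after one more letter the start is
  never seen again, so induction applies with one state fewer.\<close>

lemma card_loop_free_words:
  assumes A: "finite A"
    and loops: "\<And>s x y. residual L s \<noteq> {} \<Longrightarrow> length x = length y \<Longrightarrow>
      residual L (s @ x) = residual L s \<Longrightarrow> residual L (s @ y) = residual L s \<Longrightarrow> x = y"
    and Q: "finite Q" "{} \<notin> Q"
  shows "card {w \<in> lists A. length w = n \<and> (\<forall>u v. w = u @ v \<longrightarrow> residual L (s @ u) \<in> Q)}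
    \<le> ((card A + 1) * (n + 1)) ^ card Q"
  using Q
proof (induction "card Q" arbitrary: Q s n)
  case 0
  then have "\<not> (\<forall>u v. w = u @ v \<longrightarrow> residual L (s @ u) \<in> Q)" for w by fastforce
  then have "{w \<in> lists A. length w = n \<and> (\<forall>u v. w = u @ v \<longrightarrow> residual L (s @ u) \<in> Q)} = {}"
    by blast
  then show ?case by (simp only: card.empty zero_le)
next
  case (Suc k)
  define N where "N s n Q = {w \<in> lists A. length w = n \<and> (\<forall>u v. w = u @ v \<longrightarrow> residual L (s @ u) \<in> Q)}"
    for s n Q
  show ?case
  proof (cases "residual L s \<in> Q")
    case False
    then have "\<not> (\<forall>u v. w = u @ v \<longrightarrow> residual L (s @ u) \<in> Q)" for w
      by (metis append_Nil append_Nil2)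
    then have "N s n Q = {}" unfolding N_def by blast
    then show ?thesis unfolding N_def[symmetric] by (simp only: card.empty zero_le)
  next
    case True
    define Q' where "Q' = Q - {residual L s}"
    have Q': "card Q' = k" "finite Q'" "{} \<notin> Q'"
      using Suc True by (auto simp: Q'_def)
    have ne: "residual L s \<noteq> {}" using True Suc by auto
    \<comment> \<open>By \<open>loops\<close>, at most one loop of length \<open>m\<close> exists at
      the start; \<open>x m\<close> is that loop, or arbitrary if there is none.\<close>
    define x where "x m = (SOME x. length x = m \<and> residual L (s @ x) = residual L s)" for m
    have x: "x (length u) = u" if "residual L (s @ u) = residual L s" for u
    proof -
      have "length (x (length u)) = length u \<and> residual L (s @ x (length u)) = residual L s"
        unfolding x_def by (rule someI[of _ u]) (use that in auto)
      then show ?thesis using loops[OF ne] that by blast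
    qed
    \<comment> \<open>\<open>B (m, a)\<close> contains the words that leave the start for the last
      time at position \<open>m\<close> by the letter \<open>a\<close>; a path ending at its start
      is the single word \<open>x n\<close>.\<close>
    define B where "B = (\<lambda>(m, a). (\<lambda>w. x m @ a # w) ` N (s @ x m @ [a]) (n - Suc m) Q')"
    have finN: "finite (N s n Q)" for s n Q
      by (rule finite_subset[OF _ finite_lists_length_eq[OF A, of n]]) (auto simp: N_def)
    have "N s n Q \<subseteq> insert (x n) (\<Union>(B ` ({..<n} \<times> A)))"
    proof
      fix w assume w: "w \<in> N s n Q"
      define M where "M = {m. m \<le> n \<and> residual L (s @ take m w) = residual L s}"
      have M: "finite M" "0 \<in> M" by (auto simp: M_def)
      define m where "m = Max M"
      have "m \<in> M" unfolding m_def using M Max_in by blast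
      then have m: "m \<le> n" "residual L (s @ take m w) = residual L s" by (auto simp: M_def)
      have len: "length w = n" using w by (simp add: N_def)
      have xm: "x m = take m w" using x[OF m(2)] m(1) len by simp
      show "w \<in> insert (x n) (\<Union>(B ` ({..<n} \<times> A)))"
      proof (cases "m = n")
        case True
        then show ?thesis using xm len by simp
      next
        case False
        then have mn: "m < n" using m by simp
        define v where "v = drop (Suc m) w"
        have wv: "w = x m @ w ! m # v"
          using mn len xm by (simp add: v_def Cons_nth_drop_Suc)
        have a: "w ! m \<in> A" using w mn by (auto simp: N_def in_lists_conv_set)
        \<comment> \<open>A return to the start within \<open>v\<close> would be a visit later than
          the maximal one.\<close>
        have "residual L ((s @ x m @ [w ! m]) @ u) \<in> Q'" if u: "v = u @ t" for u t
        proof -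
          have eq: "w = (x m @ w ! m # u) @ t" using wv u by simp
          then have 1: "residual L (s @ x m @ w ! m # u) \<in> Q" using w unfolding N_def by blast
          let ?j = "m + Suc (length u)"
          have "length (x m) = m" using xm mn len by simp
          then have tk: "take ?j w = x m @ w ! m # u" by (subst eq) simp
          have "?j \<le> n" using eq len \<open>length (x m) = m\<close> by (metis le_add1 length_Cons length_append)
          moreover have "?j \<notin> M" using Max_ge[OF M(1), of ?j] by (auto simp: m_def)
          ultimately have "residual L (s @ x m @ w ! m # u) \<noteq> residual L s"
            using tk by (simp add: M_def)
          with 1 show ?thesis by (simp add: Q'_def)
        qed
        moreover have "v \<in> lists A" using w unfolding N_def v_def by (auto simp: in_lists_conv_set dest: in_set_dropD)
        moreover have "length v = n - Suc m" using len by (simp add: v_def)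
        ultimately have "v \<in> N (s @ x m @ [w ! m]) (n - Suc m) Q'" unfolding N_def by blast
        then have "w \<in> B (m, w ! m)" using wv unfolding B_def by auto
        then show ?thesis using mn a by blast
      qed
    qed
    moreover have finB: "finite (B z)" for z by (cases z) (simp add: B_def finN)
    ultimately have "card (N s n Q) \<le> card (insert (x n) (\<Union>(B ` ({..<n} \<times> A))))"
      using A by (intro card_mono) auto
    also have "\<dots> \<le> 1 + card (\<Union>(B ` ({..<n} \<times> A)))"
      by (simp add: card_insert_le_m1)
    also have "card (\<Union>(B ` ({..<n} \<times> A))) \<le> (\<Sum>z \<in> {..<n} \<times> A. card (B z))"
      using A by (intro card_UN_le) auto
    also have "\<dots> \<le> (\<Sum>z \<in> {..<n} \<times> A. ((card A + 1) * (n + 1)) ^ k)"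
    proof (rule sum_mono)
      fix z assume "z \<in> {..<n} \<times> A"
      obtain m a where z: "z = (m, a)" by (cases z)
      have "card (B z) \<le> card (N (s @ x m @ [a]) (n - Suc m) Q')"
        unfolding B_def z by (simp add: card_image_le finN)
      also have "\<dots> \<le> ((card A + 1) * (n - Suc m + 1)) ^ k"
        using Suc(1)[OF Q'(1)[symmetric] Q'(2,3)] Q'(1) unfolding N_def by blast
      also have "\<dots> \<le> ((card A + 1) * (n + 1)) ^ k"
        by (intro power_mono mult_le_mono) auto
      finally show "card (B z) \<le> ((card A + 1) * (n + 1)) ^ k" .
    qed
    also have "\<dots> = n * card A * ((card A + 1) * (n + 1)) ^ k" by (simp add: card_cartesian_product)
    \<comment> \<open>The power is at least 1 and so absorbs the summand for
      \<open>x n\<close>.\<close>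
    also have "1 + \<dots> \<le> (1 + n * card A) * ((card A + 1) * (n + 1)) ^ k"
      by (simp add: Suc_le_eq)
    also have "\<dots> \<le> ((card A + 1) * (n + 1)) * ((card A + 1) * (n + 1)) ^ k"
      by (intro mult_le_mono1) (simp add: algebra_simps)
    finally show ?thesis unfolding N_def[symmetric] Suc(2)[symmetric] power_Suc by simp
  qed
qed

text \<open>Two distinct loops of equal length at a live state can be concatenated freely, and any
  word accepted from that state completes them. Otherwise the preceding bound applies to the
  nonempty residuals, since every prefix of a word of \<open>L\<close> has a nonempty
  residual.\<close>

lemma residual_growth_dichotomy:
  assumes A: "finite A" and L: "L \<subseteq> lists A" and fin: "finite (range (residual L))"
  shows "(\<exists>k. \<forall>n. card {w \<in> L. length w = n} \<le> ((card A + 1) * (n + 1)) ^ k) \<or>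
    (\<exists>s t x y. length x = length y \<and> x \<noteq> y \<and> (\<forall>zs. set zs \<subseteq> {x, y} \<longrightarrow> s @ concat zs @ t \<in> L))"
proof (cases "\<exists>s x y. residual L s \<noteq> {} \<and> length x = length y \<and> x \<noteq> y \<and>
    residual L (s @ x) = residual L s \<and> residual L (s @ y) = residual L s")
  case True
  then obtain s x y where sxy: "residual L s \<noteq> {}" "length x = length y" "x \<noteq> y"
    "residual L (s @ x) = residual L s" "residual L (s @ y) = residual L s" by blast
  then obtain t where t: "t \<in> residual L s" by blast
  have "residual L (s @ concat zs) = residual L s" if "set zs \<subseteq> {x, y}" for zs
    using that
  proof (induction zs)
    case (Cons z zs)
    then have "residual L (s @ z) = residual L s" using sxy by auto
    moreover have "residual L (s @ concat (z # zs)) = residual (residual L (s @ z)) (concat zs)"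
      by (simp flip: residual_append)
    ultimately show ?case using Cons by (simp flip: residual_append)
  qed simp
  then have "s @ concat zs @ t \<in> L" if "set zs \<subseteq> {x, y}" for zs
    using t that unfolding residual_def by fastforce
  then show ?thesis using sxy by blast
next
  case False
  let ?Q = "range (residual L) - {{}}"
  have "card {w \<in> L. length w = n} \<le> ((card A + 1) * (n + 1)) ^ card ?Q" for n
  proof -
    let ?N = "{w \<in> lists A. length w = n \<and> (\<forall>u v. w = u @ v \<longrightarrow> residual L ([] @ u) \<in> ?Q)}"
    have "{w \<in> L. length w = n} \<subseteq> ?N" using L by (auto simp: residual_def)
    moreover have "finite ?N"
      by (rule finite_subset[OF _ finite_lists_length_eq[OF A, of n]]) auto
    ultimately have "card {w \<in> L. length w = n} \<le> card ?N" by (intro card_mono)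
    also have "\<dots> \<le> ((card A + 1) * (n + 1)) ^ card ?Q"
      by (rule card_loop_free_words) (use A False fin in \<open>blast+\<close>)
    finally show ?thesis .
  qed
  then show ?thesis by blast
qed

text \<open>Blocks of equal length can be read off from their concatenation, so the
  \<open>2 ^ k\<close> block sequences give distinct words, all of one length.\<close>

lemma card_concat_family:
  assumes A: "finite A" and L: "L \<subseteq> lists A"
    and xy: "length x = length y" "x \<noteq> y" "\<And>zs. set zs \<subseteq> {x, y} \<Longrightarrow> s @ concat zs @ t \<in> L"
  shows "2 ^ k \<le> card {w \<in> L. length w = length s + length t + k * length x}"
proof -
  let ?Z = "{zs. set zs \<subseteq> {x, y} \<and> length zs = k}"
  have "2 ^ k = card ?Z" using xy(2) by (simp add: card_lists_length_eq numeral_2_eq_2)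
  also have "\<dots> = card ((\<lambda>zs. s @ concat zs @ t) ` ?Z)"
  proof (rule card_image[symmetric], rule inj_onI)
    fix u v assume uv: "u \<in> ?Z" "v \<in> ?Z" "s @ concat u @ t = s @ concat v @ t"
    then have len: "length z = length x" if "z \<in> set u \<union> set v" for z using xy(1) that by auto
    have "length a = length b" if "(a, b) \<in> set (zip u v)" for a b
      using len[of a] len[of b] set_zip_leftD[OF that] set_zip_rightD[OF that] by simp
    then show "u = v" using uv by (intro concat_injective) auto
  qed
  also have "\<dots> \<le> card {w \<in> L. length w = length s + length t + k * length x}"
  proof (rule card_mono)
    show "finite {w \<in> L. length w = length s + length t + k * length x}"
      by (rule finite_subset[OF _ finite_lists_length_eq[OF A]]) (use L in auto)
    have "length (concat zs) = length zs * length x" if "set zs \<subseteq> {x, y}" for zs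
      using that xy(1) by (induction zs) auto
    then show "(\<lambda>zs. s @ concat zs @ t) ` ?Z \<subseteq> {w \<in> L. length w = length s + length t + k * length x}"
      using xy(3) by auto
  qed
  finally show ?thesis .
qed

section \<open>Cores of rational subsets\<close>

text \<open>Cutting the unreduced word in \<open>L\<close> makes the core readable by an automaton.
  The word \<open>u @ c @ word_inv u\<close> need not be reduced after \<open>u\<close> is reduced,
  but \<open>c\<close> is conjugate to an element represented by \<open>L\<close> in any
  case.\<close>

definition core_language :: "('s \<times> bool) list set \<Rightarrow> ('s \<times> bool) list set" where
  "core_language L = {c. cyc_reduced c \<and>
     (\<exists>u v w. u @ v @ w \<in> L \<and> free_red v = c \<and> free_red w = word_inv (free_red u))}"

lemma core_language_lists: "L \<subseteq> lists (S \<times> UNIV) \<Longrightarrow> core_language L \<subseteq> lists (S \<times> UNIV)"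
proof
  fix c assume L: "L \<subseteq> lists (S \<times> UNIV)" and "c \<in> core_language L"
  then obtain u v w where "u @ v @ w \<in> lists (S \<times> UNIV)" "free_red v = c"
    unfolding core_language_def by blast
  then show "c \<in> lists (S \<times> UNIV)"
    unfolding append_in_lists_conv using free_red_lists by blast
qed

text \<open>By \<open>free_red_split\<close>, the residual at \<open>u\<close> depends only on the first and last letter of \<open>u\<close> and on
  the pairs of residuals of \<open>L\<close> joined by some word that reduces to \<open>u\<close>.\<close>

lemma finite_residuals_core_language:
  assumes S: "finite S" and L: "L \<subseteq> lists (S \<times> UNIV)" and fin: "finite (range (residual L))"
  shows "finite (range (residual (core_language L)))"
proof -
  let ?A = "S \<times> (UNIV :: bool set)" and ?Q = "range (residual L)"
  \<comment> \<open>Residuals serve as states. \<open>Z\<close> holds the pairs between which a core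
    may be read: an outer word leads to \<open>P\<close>, and a word reducing to its inverse is
    accepted from \<open>R\<close>. \<open>T\<close> forgets the word read and keeps only its
    reduction.\<close>
  define Z where "Z = {(P, R). \<exists>u w. residual L u = P \<and> w \<in> R \<and> free_red w = word_inv (free_red u)}"
  define T where "T P g R \<longleftrightarrow> (\<exists>v. residual P v = R \<and> free_red v = g)"
    for P R :: "('a \<times> bool) list set" and g
  have core: "c \<in> core_language L \<longleftrightarrow> cyc_reduced c \<and> (\<exists>P R. (P, R) \<in> Z \<and> T P c R)" for c
  proof -
    have "u @ v @ w \<in> L \<longleftrightarrow> w \<in> residual (residual L u) v" for u v w
      by (simp add: residual_def)
    then show ?thesis unfolding core_language_def Z_def T_def by auto
  qed
  \<comment> \<open>A word reducing to \<open>g @ h\<close> passes through the vertex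
    \<open>g\<close>, where the run can be cut; the converse uses that \<open>g @ h\<close> is
    reduced.\<close>
  have T_append: "T P (g @ h) R \<longleftrightarrow> (\<exists>M. T P g M \<and> T M h R)" if "reduced (g @ h)" for P g h R
  proof
    assume "T P (g @ h) R"
    then obtain v where v: "residual P v = R" "free_red v = g @ h" unfolding T_def by blast
    then obtain v1 v2 where "v = v1 @ v2" "free_red v1 = g" "free_red v2 = h"
      using free_red_split by blast
    then show "\<exists>M. T P g M \<and> T M h R" using v(1) unfolding T_def by (metis residual_append)
  next
    assume "\<exists>M. T P g M \<and> T M h R"
    then obtain v1 v2 where v: "residual (residual P v1) v2 = R" "free_red v1 = g" "free_red v2 = h"
      unfolding T_def by blast
    have "free_red (v1 @ v2) = free_red (free_red v1 @ free_red v2)"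
      by (simp only: free_red_append_left free_red_append_right)
    then have "free_red (v1 @ v2) = g @ h" using v(2,3) that by (simp add: free_red_reduced)
    then show "T P (g @ h) R" using v(1) unfolding T_def by (metis residual_append)
  qed
  \<comment> \<open>The data \<open>(x, y, E)\<close> stand for the first letter of
    \<open>u\<close>, its last letter and the state pairs joined by \<open>u\<close>;
    \<open>last (y # v)\<close> is the last letter of \<open>u @ v\<close> even for empty
    \<open>v\<close>.\<close>
  define \<Phi> where "\<Phi> = (\<lambda>(x, y, E). {v. reduced v \<and> (v = [] \<or> hd v \<noteq> inv_letter y) \<and>
      x \<noteq> inv_letter (last (y # v)) \<and> (\<exists>P M R. (P, M) \<in> E \<and> (P, R) \<in> Z \<and> T M v R)})"
  \<comment> \<open>The empty word has no end letters and is treated apart; \<open>{}\<close> covers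
    words that are not reduced or leave the alphabet.\<close>
  have "residual (core_language L) u \<in> insert (residual (core_language L) [])
      (insert {} (\<Phi> ` (?A \<times> ?A \<times> Pow (?Q \<times> ?Q))))" for u
  proof (cases "u \<noteq> [] \<and> reduced u \<and> u \<in> lists ?A")
    case True
    define E where "E = {(P, M). P \<in> ?Q \<and> M \<in> ?Q \<and> T P u M}"
    have "v \<in> residual (core_language L) u \<longleftrightarrow> v \<in> \<Phi> (hd u, last u, E)" for v
    proof -
      have cyc: "cyc_reduced (u @ v) \<longleftrightarrow> reduced v \<and> (v = [] \<or> hd v \<noteq> inv_letter (last u)) \<and>
          hd u \<noteq> inv_letter (last (last u # v))"
        using True by (auto simp: cyc_reduced_iff reduced_append)
      have ex: "(\<exists>P R. (P, R) \<in> Z \<and> T P (u @ v) R) \<longleftrightarrow>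
          (\<exists>P M R. (P, M) \<in> E \<and> (P, R) \<in> Z \<and> T M v R)" if "reduced (u @ v)"
      proof -
        have P: "P \<in> ?Q" if "(P, R) \<in> Z" for P R using that by (auto simp: Z_def)
        have M: "M \<in> ?Q" if PM: "P \<in> ?Q" "T P u M" for P M
        proof -
          obtain u' w where "P = residual L u'" "residual P w = M" using PM unfolding T_def by blast
          then have "M = residual L (u' @ w)" by (simp only: residual_append)
          then show ?thesis by blast
        qed
        have E: "(P, M) \<in> E \<longleftrightarrow> P \<in> ?Q \<and> M \<in> ?Q \<and> T P u M" for P M
          by (simp only: E_def mem_Collect_eq case_prod_conv)
        show ?thesis unfolding T_append[OF that] E using P M by metis
      qed
      have "v \<in> residual (core_language L) u \<longleftrightarrow>
          cyc_reduced (u @ v) \<and> (\<exists>P R. (P, R) \<in> Z \<and> T P (u @ v) R)"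
        by (simp only: residual_def mem_Collect_eq core)
      also have "\<dots> \<longleftrightarrow> cyc_reduced (u @ v) \<and> (\<exists>P M R. (P, M) \<in> E \<and> (P, R) \<in> Z \<and> T M v R)"
        using ex cyc_reduced_reduced[of "u @ v"] by metis
      also have "\<dots> \<longleftrightarrow> v \<in> \<Phi> (hd u, last u, E)"
        by (simp only: \<Phi>_def cyc mem_Collect_eq case_prod_conv conj_assoc)
      finally show ?thesis .
    qed
    then have "residual (core_language L) u = \<Phi> (hd u, last u, E)" by blast
    moreover have "(hd u, last u, E) \<in> ?A \<times> ?A \<times> Pow (?Q \<times> ?Q)"
    proof -
      have "hd u \<in> ?A" "last u \<in> ?A" using True by (auto simp del: mem_Times_iff)
      moreover have "E \<in> Pow (?Q \<times> ?Q)" by (auto simp: E_def)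
      ultimately show ?thesis by (intro SigmaI)
    qed
    ultimately have "residual (core_language L) u \<in> \<Phi> ` (?A \<times> ?A \<times> Pow (?Q \<times> ?Q))"
      by (rule image_eqI)
    then show ?thesis by (intro insertI2)
  next
    case False
    show ?thesis
    proof (cases "u = []")
      case ne: False
      have "residual (core_language L) u = {}"
      proof (rule ccontr)
        assume "residual (core_language L) u \<noteq> {}"
        then obtain v where v: "u @ v \<in> core_language L" unfolding residual_def by blast
        then have "reduced (u @ v)" by (simp add: core_language_def cyc_reduced_reduced)
        moreover have "u @ v \<in> lists ?A" using v core_language_lists[OF L] by blast
        ultimately show False
          using False ne unfolding append_in_lists_conv reduced_append by blast
      qed
      then show ?thesis by blast
    qed simp
  qed
  moreover have "finite (insert (residual (core_language L) [])
      (insert {} (\<Phi> ` (?A \<times> ?A \<times> Pow (?Q \<times> ?Q)))))"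
    using S fin by simp
  ultimately show ?thesis by (metis (no_types, lifting) finite_subset image_subset_iff)
qed

section \<open>From rational subsets to core languages\<close>

text \<open>The residual at a word over \<open>A\<close> depends only on the state reached; at other
  words it is empty.\<close>

lemma regular_language_finite_residuals:
  assumes "regular_language A L"
  shows "finite (range (residual L))"
proof -
  obtain Q :: "nat set" and \<delta> q\<^sub>0 F where Q: "finite Q" "q\<^sub>0 \<in> Q" "\<forall>q \<in> Q. \<forall>x \<in> A. \<delta> q x \<in> Q"
    and L: "L = {w \<in> lists A. foldl \<delta> q\<^sub>0 w \<in> F}"
    using assms unfolding regular_language_def by blast
  have st: "foldl \<delta> q w \<in> Q" if "q \<in> Q" "w \<in> lists A" for q w
    using that(2,1) by (induction w arbitrary: q) (simp_all add: Q(3))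
  define \<Psi> where "\<Psi> q = {v \<in> lists A. foldl \<delta> q v \<in> F}" for q
  have "residual L u \<in> insert {} (\<Psi> ` Q)" for u
  proof (cases "u \<in> lists A")
    case True
    then have "residual L u = \<Psi> (foldl \<delta> q\<^sub>0 u)"
      unfolding residual_def \<Psi>_def L by auto
    then show ?thesis using st[OF Q(2) True] by blast
  next
    case False
    then have "residual L u = {}" unfolding residual_def L by auto
    then show ?thesis by blast
  qed
  then have "range (residual L) \<subseteq> insert {} (\<Psi> ` Q)" by blast
  then show ?thesis by (rule finite_subset) (simp add: Q(1))
qed

text \<open>The language is pulled back along \<open>map (\<lambda>x. [x])\<close> to a language of
  plain letters; its residuals are preimages of the old ones, so they remain finite in
  number.\<close>

lemma rational_subset_free_group:
  assumes "rational_subset (free_group S) (free_basis S) U"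
  obtains L where "L \<subseteq> lists (S \<times> UNIV)" "finite (range (residual L))" "U = free_red ` L"
proof -
  obtain L0 where reg: "regular_language (sym_gens (free_group S) (free_basis S)) L0"
    and U: "word_eval (free_group S) ` L0 = U"
    using assms unfolding rational_subset_def by blast
  let ?f = "map (\<lambda>x. [x]) :: ('a \<times> bool) list \<Rightarrow> _"
  define L where "L = ?f -` L0"
  have "L0 \<subseteq> ?f ` lists (S \<times> UNIV)"
    using reg unfolding regular_language_def lists_sym_gens_free_group by blast
  moreover have "inj ?f" by (simp add: inj_def)
  ultimately have "L \<subseteq> lists (S \<times> UNIV)"
    unfolding L_def by (metis (lifting) inj_vimage_image_eq vimage_mono)
  have "L0 = ?f ` L" using \<open>L0 \<subseteq> _\<close> unfolding L_def by blast
  have "residual L u = ?f -` residual L0 (?f u)" for u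
    by (auto simp: residual_def L_def)
  then have "range (residual L) \<subseteq> (\<lambda>R. ?f -` R) ` range (residual L0)" by blast
  then have "finite (range (residual L))"
    using regular_language_finite_residuals[OF reg] by (meson finite_imageI finite_subset)
  moreover have "U = free_red ` L"
    using U \<open>L0 = ?f ` L\<close> by (simp add: image_image word_eval_free_group)
  ultimately show ?thesis using that \<open>L \<subseteq> lists (S \<times> UNIV)\<close> by blast
qed

text \<open>A core \<open>c\<close> cut from \<open>u @ v @ w\<close> is conjugate to the element
  represented, by \<open>free_red u\<close>. Conversely, writing an element as
  \<open>p @ c @ word_inv p\<close> and applying \<open>free_red_split\<close> cuts any word for it
  into parts that exhibit \<open>c\<close> as a core.\<close>

lemma conj_growth_core_language:
  assumes L: "L \<subseteq> lists (S \<times> UNIV)"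
  shows "conj_growth (free_group S) (free_basis S) (free_red ` L) n
       = card (conj_class (free_group S) ` {c \<in> core_language L. length c = n})"
proof -
  have u_carrier: "free_red u \<in> carrier (free_group S)" if "u @ w \<in> L" for u w
    using subsetD[OF L that] free_red_lists[of u S] by (simp del: in_lists_conv_set)
  show ?thesis
  proof (rule conj_growth_classes)
    show "core_language L \<subseteq> {c \<in> lists (S \<times> UNIV). cyc_reduced c}"
      using core_language_lists[OF L] by (auto simp: core_language_def)
  next
    fix c assume c: "c \<in> core_language L"
    then obtain u v w where uvw: "u @ v @ w \<in> L" "free_red v = c" "free_red w = word_inv (free_red u)"
      by (auto simp: core_language_def)
    have "free_red (u @ v @ w) = free_red (free_red u @ free_red v @ free_red w)"
      by (metis append_assoc free_red_append_left free_red_append_right)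
    then have "free_red (u @ v @ w) = free_red (free_red u @ c @ word_inv (free_red u))"
      using uvw by simp
    moreover have "free_red u \<in> carrier (free_group S)"
      using uvw(1) by (rule u_carrier)
    moreover have "c \<in> carrier (free_group S)"
      using c core_language_lists[OF L] by (auto simp: core_language_def cyc_reduced_reduced)
    ultimately have "free_red (u @ v @ w) \<in> conj_class (free_group S) c"
      unfolding conj_class_free_group[OF \<open>c \<in> carrier (free_group S)\<close>] by blast
    then show "conj_class (free_group S) c \<inter> free_red ` L \<noteq> {}" using uvw(1) by blast
  next
    fix g assume "g \<in> free_red ` L"
    then obtain z where z: "g = free_red z" "z \<in> L" by blast
    obtain p c where pc: "g = p @ c @ word_inv p" "cyc_reduced c"
      using reduced_decomp[of g] z(1) by auto
    then obtain u v w where uvw: "z = u @ v @ w" "free_red u = p" "free_red v = c" "free_red w = word_inv p"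
      using free_red_split z(1) by metis
    have c: "c \<in> core_language L"
      unfolding core_language_def using uvw z(2) pc(2) by blast
    have "c \<in> carrier (free_group S)"
      using c core_language_lists[OF L] by (auto simp: core_language_def cyc_reduced_reduced)
    moreover have "p \<in> carrier (free_group S)"
      using uvw(1,2) z(2) by (blast intro: u_carrier)
    moreover have "g = free_red (p @ c @ word_inv p)"
      using z(1) pc(1) by (metis free_red_idem)
    ultimately show "\<exists>c \<in> core_language L. conj_class (free_group S) c = conj_class (free_group S) g"
      using c conj_class_eqI by metis
  qed
qed

section \<open>Comparing words with classes, and exponential growth\<close>

text \<open>The cyclically reduced words of length \<open>n\<close> in one class are rotations of a
  single word, hence at most \<open>n\<close> in number. For \<open>n = 0\<close> the empty word
  would still be one word, while the factor vanishes.\<close>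

lemma card_le_card_conj_classes:
  assumes S: "finite S" and V: "V \<subseteq> {c \<in> lists (S \<times> UNIV). cyc_reduced c}" and n: "n > 0"
  shows "card {c \<in> V. length c = n} \<le> n * card (conj_class (free_group S) ` {c \<in> V. length c = n})"
proof -
  let ?cc = "conj_class (free_group S)"
  let ?W = "{c \<in> V. length c = n}"
  have "finite (S \<times> (UNIV :: bool set))" using S by simp
  then have "finite {c. set c \<subseteq> S \<times> (UNIV :: bool set) \<and> length c = n}" by (rule finite_lists_length_eq)
  then have fin: "finite ?W" by (rule rev_finite_subset) (use V in auto)
  have "card ?W \<le> card (\<Union>K \<in> ?cc ` ?W. {c \<in> ?W. ?cc c = K})"
    by (rule card_mono) (use fin in \<open>auto intro: finite_subset[OF _ fin]\<close>)
  also have "\<dots> \<le> (\<Sum>K \<in> ?cc ` ?W. card {c \<in> ?W. ?cc c = K})"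
    by (rule card_UN_le) (use fin in auto)
  also have "\<dots> \<le> (\<Sum>K \<in> ?cc ` ?W. n)"
  proof (rule sum_mono)
    fix K assume "K \<in> ?cc ` ?W"
    then obtain d where d: "d \<in> ?W" "K = ?cc d" by blast
    have "{c \<in> ?W. ?cc c = K} \<subseteq> (\<lambda>m. rotate m d) ` {..<n}"
    proof
      fix c assume "c \<in> {c \<in> ?W. ?cc c = K}"
      then obtain m where "c = rotate m d"
        using d V conj_class_eq_imp_rotate[of d S c] by blast
      then have "c = rotate (m mod n) d" using d by (metis (lifting) mem_Collect_eq rotate_conv_mod)
      then show "c \<in> (\<lambda>m. rotate m d) ` {..<n}" using n by auto
    qed
    then have "card {c \<in> ?W. ?cc c = K} \<le> card ((\<lambda>m. rotate m d) ` {..<n})"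
      by (intro card_mono) auto
    also have "\<dots> \<le> n" using card_image_le[of "{..<n}"] by fastforce
    finally show "card {c \<in> ?W. ?cc c = K} \<le> n" .
  qed
  finally show ?thesis by (simp add: mult.commute)
qed

text \<open>If the limsup were at most 1, \<open>f n\<close> would eventually be at most
  \<open>r ^ n\<close> for each \<open>r > 1\<close>; along \<open>n = m + k * l\<close> this
  contradicts the growth \<open>2 ^ k\<close>, even with the factor \<open>n\<close> lost.\<close>

lemma limsup_root_gt_1:
  fixes f :: "nat \<Rightarrow> nat"
  assumes l: "l > 0" and f: "\<And>k. k > 0 \<Longrightarrow> 2 ^ k \<le> (m + k * l) * f (m + k * l)"
  shows "limsup (\<lambda>n. ereal (root n (real (f n)))) > 1"
proof (rule ccontr)
  \<comment> \<open>Chosen so that \<open>r ^ l = sqrt 2\<close>: of \<open>2 ^ k\<close> a factor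
    \<open>sqrt 2 ^ k\<close> is left over, which outgrows
    \<open>(m + k * l) * r ^ m\<close>.\<close>
  define r where "r = (2::real) powr (1 / (2 * l))"
  have r: "r > 1" using l by (simp add: r_def)
  have "r ^ l = 2 powr (1 / 2)"
    using l r by (simp add: r_def powr_powr flip: powr_realpow)
  then have rl: "r ^ l = sqrt 2" by (simp add: powr_half_sqrt)
  assume "\<not> ?thesis"
  then have "limsup (\<lambda>n. ereal (root n (real (f n)))) \<le> 1" by simp
  also have "1 < ereal r" using r by simp
  finally have "\<forall>\<^sub>F n in sequentially. ereal (root n (real (f n))) < ereal r"
    by (rule Limsup_lessD)
  moreover have "filterlim (\<lambda>k. m + k * l) at_top at_top"
    by (rule filterlim_subseq) (use l in \<open>simp add: strict_mono_def\<close>)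
  ultimately have "\<forall>\<^sub>F k in sequentially. ereal (root (m + k * l) (real (f (m + k * l)))) < ereal r"
    by (rule eventually_compose_filterlim)
  moreover have "\<forall>\<^sub>F k in sequentially. (real m + real k * real l) * r ^ m < sqrt 2 ^ k"
    using l r by real_asymp
  ultimately have "\<forall>\<^sub>F k::nat in sequentially. False"
    using eventually_gt_at_top[of 0]
  proof eventually_elim
    case (elim k)
    let ?n = "m + k * l"
    have n: "?n > 0" using elim l by simp
    have "real (f ?n) = root ?n (real (f ?n)) ^ ?n" using n by simp
    also have "\<dots> \<le> r ^ ?n" using elim n by (intro power_mono) auto
    also have "\<dots> = r ^ m * sqrt 2 ^ k"
      by (simp add: power_add rl power_mult mult.commute[of k])
    finally have "real ?n * real (f ?n) \<le> real ?n * (r ^ m * sqrt 2 ^ k)"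
      by (intro mult_left_mono) auto
    also have "\<dots> = ((real m + real k * real l) * r ^ m) * sqrt 2 ^ k" by simp
    also have "\<dots> < sqrt 2 ^ k * sqrt 2 ^ k" using elim by (intro mult_strict_right_mono) auto
    also have "\<dots> = 2 ^ k" by (simp flip: power_mult_distrib)
    finally have "real (?n * f ?n) < 2 ^ k" by simp
    moreover have "real (2 ^ k) \<le> real (?n * f ?n)" using f[of k] elim by (simp only: of_nat_le_iff)
    ultimately show False by simp
  qed
  then show False by simp
qed

text \<open>An upper bound on the number of core words bounds the number of classes at once; a lower
  bound loses only a factor \<open>n\<close>.\<close>

theorem conj_growth_rational_dichotomy:
  assumes S: "finite S" and U: "rational_subset (free_group S) (free_basis S) U"
  shows "(\<exists>p :: real poly. \<forall>n. real (conj_growth (free_group S) (free_basis S) U n) \<le> poly p (real n)) \<or>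
    limsup (\<lambda>n. ereal (root n (real (conj_growth (free_group S) (free_basis S) U n)))) > 1"
proof -
  obtain L where L: "L \<subseteq> lists (S \<times> UNIV)" "finite (range (residual L))" "U = free_red ` L"
    using rational_subset_free_group[OF U] .
  let ?A = "S \<times> (UNIV :: bool set)" and ?V = "core_language L"
  let ?c = "conj_growth (free_group S) (free_basis S) U"
  have c: "?c n = card (conj_class (free_group S) ` {c \<in> ?V. length c = n})" for n
    unfolding L(3) by (rule conj_growth_core_language) (rule L(1))
  have A: "finite ?A" using S by simp
  have V: "?V \<subseteq> lists ?A" by (rule core_language_lists) (rule L(1))
  then have V': "?V \<subseteq> {c \<in> lists ?A. cyc_reduced c}" by (auto simp: core_language_def)
  from residual_growth_dichotomy[OF A V finite_residuals_core_language[OF S L(1,2)]]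
  show ?thesis
  proof (elim disjE exE conjE)
    fix k assume k: "\<forall>n. card {w \<in> ?V. length w = n} \<le> ((card ?A + 1) * (n + 1)) ^ k"
    let ?C = "real (card ?A + 1)"
    have "real (?c n) \<le> poly ([:?C, ?C:] ^ k) (real n)" for n
    proof -
      have "finite {c \<in> ?V. length c = n}"
        by (rule finite_subset[OF _ finite_lists_length_eq[OF A, of n]]) (use V in auto)
      then have "?c n \<le> card {c \<in> ?V. length c = n}" unfolding c by (rule card_image_le)
      also have "\<dots> \<le> ((card ?A + 1) * (n + 1)) ^ k" using k by blast
      finally have "real (?c n) \<le> real (((card ?A + 1) * (n + 1)) ^ k)" by (simp only: of_nat_le_iff)
      also have "\<dots> = poly ([:?C, ?C:] ^ k) (real n)"
        by (simp add: poly_power algebra_simps del: card_cartesian_product)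
      finally show ?thesis .
    qed
    then show ?thesis by blast
  next
    fix s t x y
    assume xy: "length x = length y" "x \<noteq> y"
      and st: "\<forall>zs. set zs \<subseteq> {x, y} \<longrightarrow> s @ concat zs @ t \<in> ?V"
    \<comment> \<open>Distinct words of equal length are nonempty, so the lengths \<open>?n\<close>
      grow with \<open>k\<close>.\<close>
    have l: "length x > 0" using xy by auto
    have "limsup (\<lambda>n. ereal (root n (real (?c n)))) > 1"
    proof (rule limsup_root_gt_1[OF l])
      fix k :: nat assume k: "k > 0"
      let ?n = "length s + length t + k * length x"
      have "2 ^ k \<le> card {w \<in> ?V. length w = ?n}"
        by (rule card_concat_family[OF A V xy]) (use st in blast)
      also have "\<dots> \<le> ?n * ?c ?n"
        unfolding c by (rule card_le_card_conj_classes[OF S V']) (use k l in simp)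
      finally show "2 ^ k \<le> ?n * ?c ?n" .
    qed
    then show ?thesis ..
  qed
qed

section \<open>Polynomial growth of prescribed degree\<close>

text \<open>The two letters \<open>b\<close> of the suffix shield the inverse of \<open>a\<close>
  from any letter \<open>a\<close>, before it and, cyclically, after it.\<close>

definition marked_words :: "'s \<Rightarrow> 's \<Rightarrow> nat \<Rightarrow> ('s \<times> bool) list set" where
  "marked_words a b e = {w @ [(b, True), (a, False), (b, True)] | w.
     set w \<subseteq> {(a, True), (b, True)} \<and> count_list w (b, True) = e}"

text \<open>States up to \<open>e\<close> count the letters \<open>b\<close> read. The next
  \<open>b\<close> must open the suffix, which makes the automaton deterministic; states
  \<open>e + 1\<close> and \<open>e + 2\<close> await its remaining letters, \<open>e + 3\<close>
  accepts and \<open>e + 4\<close> is the sink.\<close>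

definition marked_step :: "'s \<Rightarrow> 's \<Rightarrow> nat \<Rightarrow> nat \<Rightarrow> 's \<times> bool \<Rightarrow> nat" where
  "marked_step a b e q x =
     (if q \<le> e \<and> x = (a, True) then q
      else if q \<le> e \<and> x = (b, True) then Suc q
      else if q = e + 1 \<and> x = (a, False) then e + 2
      else if q = e + 2 \<and> x = (b, True) then e + 3
      else e + 4)"

lemma marked_step_sink: "q > e + 3 \<Longrightarrow> foldl (marked_step a b e) q w > e + 3"
  by (induction w arbitrary: q) (auto simp: marked_step_def)

lemma marked_step_accept3: "foldl (marked_step a b e) (e + 3) w = e + 3 \<longleftrightarrow> w = []"
proof (cases w)
  case (Cons x v)
  have "marked_step a b e (e + 3) x = e + 4" by (simp add: marked_step_def)
  then show ?thesis using Cons marked_step_sink[of e "e + 4" a b v] by simp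
qed simp

lemma marked_step_accept2: "foldl (marked_step a b e) (e + 2) w = e + 3 \<longleftrightarrow> w = [(b, True)]"
proof (cases w)
  case (Cons x v)
  have "marked_step a b e (e + 2) x = (if x = (b, True) then e + 3 else e + 4)"
    by (simp add: marked_step_def)
  then show ?thesis using Cons marked_step_sink[of e "e + 4" a b v] marked_step_accept3[of a b e v]
    by simp
qed simp

lemma marked_step_accept1:
  "foldl (marked_step a b e) (e + 1) w = e + 3 \<longleftrightarrow> w = [(a, False), (b, True)]"
proof (cases w)
  case (Cons x v)
  have "marked_step a b e (e + 1) x = (if x = (a, False) then e + 2 else e + 4)"
    by (simp add: marked_step_def)
  then show ?thesis using Cons marked_step_sink[of e "e + 4" a b v] marked_step_accept2[of a b e v]
    by simp
qed simp

lemma marked_step_accept: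
  assumes "a \<noteq> b" "q \<le> e"
  shows "foldl (marked_step a b e) q w = e + 3 \<longleftrightarrow>
    (\<exists>u. w = u @ [(b, True), (a, False), (b, True)] \<and>
      set u \<subseteq> {(a, True), (b, True)} \<and> count_list u (b, True) = e - q)"
    (is "?acc q w \<longleftrightarrow> ?R q w")
  using assms(2)
proof (induction w arbitrary: q)
  case (Cons x w)
  \<comment> \<open>A first letter \<open>b\<close> either opens the suffix, when the counter is
    full, or is counted in \<open>u\<close>; a first letter \<open>a\<close> leaves the counter
    unchanged.\<close>
  have split: "?R q (x # w) \<longleftrightarrow>
      (x = (b, True) \<and> w = [(a, False), (b, True)] \<and> e = q) \<or>
      (x = (a, True) \<and> ?R q w) \<or>
      (x = (b, True) \<and> q < e \<and> ?R (Suc q) w)"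
  proof
    assume "?R q (x # w)"
    then obtain u where u: "x # w = u @ [(b, True), (a, False), (b, True)]"
      "set u \<subseteq> {(a, True), (b, True)}" "count_list u (b, True) = e - q" by blast
    show "(x = (b, True) \<and> w = [(a, False), (b, True)] \<and> e = q) \<or>
      (x = (a, True) \<and> ?R q w) \<or> (x = (b, True) \<and> q < e \<and> ?R (Suc q) w)"
    proof (cases u)
      case Nil
      then show ?thesis using u Cons.prems by simp
    next
      case (Cons y v)
      then have v: "x = y" "w = v @ [(b, True), (a, False), (b, True)]"
        "set v \<subseteq> {(a, True), (b, True)}" "y = (a, True) \<or> y = (b, True)" using u by auto
      show ?thesis
      proof (cases "y = (b, True)")
        case True
        then have "q < e" "count_list v (b, True) = e - Suc q" using u(3) Cons by auto
        then show ?thesis using v True by blast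
      next
        case False
        then have "count_list v (b, True) = e - q" using u(3) Cons by simp
        then show ?thesis using v False by blast
      qed
    qed
  next
    assume "(x = (b, True) \<and> w = [(a, False), (b, True)] \<and> e = q) \<or>
      (x = (a, True) \<and> ?R q w) \<or> (x = (b, True) \<and> q < e \<and> ?R (Suc q) w)"
    then consider "x = (b, True)" "w = [(a, False), (b, True)]" "e = q"
      | u where "x = (a, True)" "w = u @ [(b, True), (a, False), (b, True)]"
        "set u \<subseteq> {(a, True), (b, True)}" "count_list u (b, True) = e - q"
      | u where "x = (b, True)" "q < e" "w = u @ [(b, True), (a, False), (b, True)]"
        "set u \<subseteq> {(a, True), (b, True)}" "count_list u (b, True) = e - Suc q"
      by blast
    then show "?R q (x # w)"
    proof cases
      case 1
      then show ?thesis by (intro exI[of _ "[]"]) simp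
    next
      case 2
      then show ?thesis using assms(1) by (intro exI[of _ "x # u"]) simp
    next
      case 3
      then show ?thesis by (intro exI[of _ "x # u"]) simp
    qed
  qed
  consider "x = (a, True)" | "x = (b, True)" "q < e" | "x = (b, True)" "q = e"
    | "x \<noteq> (a, True)" "x \<noteq> (b, True)" using Cons.prems by fastforce
  then show ?case
  proof cases
    case 1
    then have "marked_step a b e q x = q" using Cons.prems by (simp add: marked_step_def)
    then show ?thesis unfolding split using 1 assms(1) Cons by simp
  next
    case 2
    then have "marked_step a b e q x = Suc q" using assms(1) by (simp add: marked_step_def)
    then show ?thesis unfolding split using 2 assms(1) Cons.IH[of "Suc q"] by simp
  next
    case 3
    then have "marked_step a b e q x = e + 1" using assms(1) by (simp add: marked_step_def)
    then show ?thesis unfolding split using 3 assms(1) marked_step_accept1[of a b e w] by auto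
  next
    case 4
    then have "marked_step a b e q x = e + 4" using Cons.prems by (simp add: marked_step_def)
    then show ?thesis unfolding split using 4 marked_step_sink[of e "e + 4" a b w] by simp
  qed
qed (use assms in auto)

lemma marked_words_iff:
  "a \<noteq> b \<Longrightarrow> w \<in> marked_words a b e \<longleftrightarrow> foldl (marked_step a b e) 0 w = e + 3"
  using marked_step_accept[of a b 0 e w] by (simp add: marked_words_def)

lemma marked_words_lists: "marked_words a b e \<subseteq> lists ({a, b} \<times> UNIV)"
  by (auto simp: marked_words_def)

lemma marked_words_cyc_reduced:
  assumes "a \<noteq> b" "w \<in> marked_words a b e"
  shows "cyc_reduced w"
proof -
  obtain u where w: "w = u @ [(b, True), (a, False), (b, True)]" and u: "set u \<subseteq> {(a, True), (b, True)}"
    using assms(2) by (auto simp: marked_words_def)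
  have pos: "reduced v" if "\<forall>x \<in> set v. snd x" for v :: "('a \<times> bool) list"
    using that
  proof (induction v)
    case (Cons x v)
    then show ?case by (cases v) (auto simp: reduced_Cons inv_letter_def)
  qed simp
  have "reduced (u @ [(b, True)])" by (rule pos) (use u in auto)
  moreover have "reduced [(a, False), (b, True)]" using assms(1)
    by (simp add: reduced_Cons inv_letter_def)
  ultimately have "reduced w"
    unfolding w reduced_append using assms(1) by (auto simp: inv_letter_def reduced_Cons)
  \<comment> \<open>The first letter is positive while the inverse of the last letter is not, so the
    wrap-around pair does not cancel.\<close>
  moreover have "snd (hd w)" using u unfolding w by (cases u) auto
  then have "hd w \<noteq> inv_letter (last w)" unfolding w by (auto simp: inv_letter_def)
  ultimately show ?thesis by (simp add: cyc_reduced_iff)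
qed

text \<open>In each of the two words exactly one letter follows the unique
  \<open>(a, False)\<close>. If that letter lies in \<open>u\<close>, comparing what follows it in
  \<open>u @ v\<close> and in \<open>v @ u\<close> forces \<open>v = []\<close>; symmetrically for
  \<open>v\<close>.\<close>

lemma marked_words_rotate_eq:
  assumes ab: "a \<noteq> b" and c: "c \<in> marked_words a b e" and d: "rotate m c \<in> marked_words a b e"
  shows "rotate m c = c"
proof -
  define u v where "u = take (m mod length c) c" and "v = drop (m mod length c) c"
  have uv: "c = u @ v" "rotate m c = v @ u" by (simp_all add: u_def v_def rotate_drop_take)
  have mark: "s = [(b, True)]" if ps: "p @ (a, False) # s \<in> marked_words a b e" for p s
  proof -
    obtain w where w: "p @ (a, False) # s = (w @ [(b, True)]) @ (a, False) # [(b, True)]"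
      "set w \<subseteq> {(a, True), (b, True)}"
      using ps by (auto simp: marked_words_def)
    have "(a, False) \<notin> set (w @ [(b, True)])" "(a, False) \<notin> set [(b, True)]"
      using w(2) ab by auto
    then show ?thesis using w(1) append_Cons_eq_iff by metis
  qed
  have "(a, False) \<in> set c" using c by (auto simp: marked_words_def)
  then consider "(a, False) \<in> set u" | "(a, False) \<in> set v" using uv by auto
  then have "u = [] \<or> v = []"
  proof cases
    case 1
    then obtain u1 u2 where u: "u = u1 @ (a, False) # u2" by (meson split_list)
    have "u2 @ v = [(b, True)]" "u2 = [(b, True)]"
      using mark[of u1 "u2 @ v"] mark[of "v @ u1" u2] c d uv u by simp_all
    then show ?thesis by simp
  next
    case 2
    then obtain v1 v2 where v: "v = v1 @ (a, False) # v2" by (meson split_list)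
    have "v2 @ u = [(b, True)]" "v2 = [(b, True)]"
      using mark[of v1 "v2 @ u"] mark[of "u @ v1" v2] c d uv v by simp_all
    then show ?thesis by simp
  qed
  then show ?thesis using uv by auto
qed

lemma free_red_marked_words:
  assumes "a \<noteq> b"
  shows "free_red ` marked_words a b e = marked_words a b e"
  using marked_words_cyc_reduced[OF assms, of _ e]
  by (auto simp: image_iff free_red_reduced cyc_reduced_reduced)

lemma rational_subset_marked_words:
  assumes "a \<noteq> b"
  shows "rational_subset (free_group {a, b}) (free_basis {a, b}) (marked_words a b e)"
proof -
  let ?f = "map (\<lambda>x. [x]) :: ('a \<times> bool) list \<Rightarrow> _"
  let ?A = "sym_gens (free_group {a, b}) (free_basis {a, b})"
  let ?L = "?f ` marked_words a b e"
  \<comment> \<open>\<open>hd\<close> unwraps the one-letter generators.\<close>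
  define \<delta> where "\<delta> q x = marked_step a b e q (hd x)" for q and x :: "('a \<times> bool) list"
  have fold: "foldl \<delta> q (?f w) = foldl (marked_step a b e) q w" for q w
    by (simp add: foldl_map \<delta>_def)
  have "?L = {w \<in> lists ?A. foldl \<delta> 0 w \<in> {e + 3}}"
    unfolding lists_sym_gens_free_group
    using marked_words_lists[of a b e] marked_words_iff[OF assms, of _ e] by (auto simp: fold)
  moreover have "\<delta> q x \<in> {..e + 4}" for q x
    by (simp add: \<delta>_def marked_step_def)
  ultimately have "regular_language ?A ?L"
    unfolding regular_language_def
    by (intro exI[of _ "{..e + 4}"] exI[of _ \<delta>] exI[of _ 0] exI[of _ "{e + 3}"]) auto
  moreover have "word_eval (free_group {a, b}) ` ?L = marked_words a b e"
    using free_red_marked_words[OF assms] by (simp add: image_image word_eval_free_group)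
  ultimately show ?thesis unfolding rational_subset_def by blast
qed

section \<open>Counting marked words, generating function and asymptotics\<close>

text \<open>Splitting by the first letter yields Pascal's rule.\<close>

lemma card_words_count_list:
  assumes "x \<noteq> y"
  shows "card {w. set w \<subseteq> {x, y} \<and> length w = n \<and> count_list w y = e} = n choose e"
proof (induction n arbitrary: e)
  case 0
  show ?case
  proof (cases e)
    case 0
    then have "{w. set w \<subseteq> {x, y} \<and> length w = 0 \<and> count_list w y = e} = {[]}" by auto
    then show ?thesis using 0 by simp
  next
    case (Suc e')
    then have "{w. set w \<subseteq> {x, y} \<and> length w = 0 \<and> count_list w y = e} = {}" by auto
    then show ?thesis using Suc by simp
  qed
next
  case (Suc n)
  let ?S = "\<lambda>n e. {w. set w \<subseteq> {x, y} \<and> length w = n \<and> count_list w y = e}"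
  have fin: "finite (?S n e)" for n e
    by (rule finite_subset[OF _ finite_lists_length_eq[of "{x, y}" n]]) auto
  show ?case
  proof (cases e)
    case 0
    have "?S (Suc n) e = (#) x ` ?S n e"
      using assms 0 by (auto simp: length_Suc_conv image_iff split: if_splits)
    then show ?thesis using Suc[of e] 0 by (simp add: card_image)
  next
    case (Suc e')
    have "?S (Suc n) e = (#) x ` ?S n e \<union> (#) y ` ?S n e'"
      using assms Suc by (auto simp: length_Suc_conv image_iff split: if_splits)
    moreover have "card ((#) x ` ?S n e \<union> (#) y ` ?S n e') = card ((#) x ` ?S n e) + card ((#) y ` ?S n e')"
      by (rule card_Un_disjoint) (use fin assms in auto)
    ultimately show ?thesis using Suc.IH[of e] Suc.IH[of e'] Suc by (simp add: card_image)
  qed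
qed

text \<open>Distinct marked words lie in distinct classes, so only the words before the suffix of
  length 3 have to be counted.\<close>

lemma conj_growth_marked_words:
  assumes ab: "a \<noteq> b"
  shows "conj_growth (free_group {a, b}) (free_basis {a, b}) (marked_words a b e) n
    = (if n < 3 then 0 else (n - 3) choose e)"
proof -
  let ?M = "marked_words a b e" and ?cc = "conj_class (free_group {a, b})"
  have M: "?M \<subseteq> {c \<in> lists ({a, b} \<times> UNIV). cyc_reduced c}"
    using marked_words_lists[of a b e] marked_words_cyc_reduced[OF ab] by blast
  have carrier: "c \<in> carrier (free_group {a, b})" if "c \<in> ?M" for c
    using subsetD[OF M that] by (simp add: cyc_reduced_reduced)
  have "conj_growth (free_group {a, b}) (free_basis {a, b}) ?M n = card (?cc ` {c \<in> ?M. length c = n})"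
    by (rule conj_growth_classes[OF M]) (use carrier conj_class_self in blast)+
  also have "\<dots> = card {c \<in> ?M. length c = n}"
  proof (rule card_image, rule inj_onI)
    fix c d assume cd: "c \<in> {c \<in> ?M. length c = n}" "d \<in> {c \<in> ?M. length c = n}" "?cc c = ?cc d"
    then obtain m where "d = rotate m c"
      using M conj_class_eq_imp_rotate[of c "{a, b}" d] by blast
    then show "c = d" using cd marked_words_rotate_eq[OF ab, of c e m] by simp
  qed
  also have "\<dots> = (if n < 3 then 0 else (n - 3) choose e)"
  proof (cases "n < 3")
    case True
    then have "{c \<in> ?M. length c = n} = {}" by (auto simp: marked_words_def)
    then show ?thesis using True by (simp only: card.empty if_True)
  next
    case False
    let ?W = "{w. set w \<subseteq> {(a, True), (b, True)} \<and> length w = n - 3 \<and> count_list w (b, True) = e}"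
    have "{c \<in> ?M. length c = n} = (\<lambda>w. w @ [(b, True), (a, False), (b, True)]) ` ?W"
      using False by (auto simp: marked_words_def)
    then have "card {c \<in> ?M. length c = n} = card ?W"
      by (simp add: card_image inj_on_def)
    also have "\<dots> = (n - 3) choose e"
      by (rule card_words_count_list) (use ab in simp)
    finally show ?thesis using False by simp
  qed
  finally show ?thesis .
qed

text \<open>The generating function of a column of Pascal's triangle, with the denominator
  cleared.\<close>

lemma fps_binomial_column:
  "Abs_fps (\<lambda>n. of_nat (n choose e)) * (1 - fps_X) ^ Suc e = (fps_X ^ e :: rat fps)"
proof (induction e)
  case 0
  show ?case by (rule fps_ext) (simp add: right_diff_distrib)
next
  case (Suc e)
  let ?F = "\<lambda>e. Abs_fps (\<lambda>n. of_nat (n choose e)) :: rat fps"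
  \<comment> \<open>Pascal's rule, read coefficient by coefficient.\<close>
  have step: "?F (Suc e) * (1 - fps_X) = fps_X * ?F e"
  proof (rule fps_ext)
    fix n
    show "fps_nth (?F (Suc e) * (1 - fps_X)) n = fps_nth (fps_X * ?F e) n"
      by (cases n) (simp_all add: right_diff_distrib)
  qed
  have "?F (Suc e) * (1 - fps_X) ^ Suc (Suc e) = (?F (Suc e) * (1 - fps_X)) * (1 - fps_X) ^ Suc e"
    by (simp add: mult.assoc)
  also have "\<dots> = fps_X * (?F e * (1 - fps_X) ^ Suc e)"
    unfolding step by (simp add: mult.assoc)
  finally show ?case unfolding Suc by simp
qed

text \<open>The shift multiplies the column series by \<open>fps_X ^ m\<close>, giving numerator
  \<open>fps_X ^ (m + e)\<close> and denominator \<open>(1 - fps_X) ^ Suc e\<close>.\<close>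

lemma rational_fps_shifted_binomial:
  "rational_fps (Abs_fps (\<lambda>n. of_nat (if n < m then 0 else (n - m) choose e)) :: rat fps)"
proof -
  let ?f = "Abs_fps (\<lambda>n. of_nat (if n < m then 0 else (n - m) choose e)) :: rat fps"
  let ?p = "monom 1 (m + e) :: rat poly" and ?q = "[:1, - 1:] ^ Suc e :: rat poly"
  have q: "fps_of_poly ?q = (1 - fps_X) ^ Suc e"
    by (simp add: fps_of_poly_power fps_of_poly_pCons del: power_Suc)
  have "?f = fps_X ^ m * Abs_fps (\<lambda>n. of_nat (n choose e))"
    by (rule fps_ext) (simp add: fps_X_power_mult_nth)
  then have "?f * fps_of_poly ?q = fps_of_poly ?p"
    unfolding q by (simp only: mult.assoc fps_binomial_column) (simp add: fps_of_poly_monom power_add)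
  moreover have c: "coeff ?q 0 \<noteq> 0" by (simp add: coeff_0_power del: power_Suc)
  then have "fps_of_poly ?q \<noteq> 0" by (metis fps_of_poly_nth fps_zero_nth)
  ultimately have "?f = fps_of_poly ?p / fps_of_poly ?q"
    by (metis nonzero_mult_div_cancel_right)
  then show ?thesis unfolding rational_fps_def using c by blast
qed

lemma bigtheta_shifted_binomial:
  "(\<lambda>n. real (if n < m then 0 else (n - m) choose e)) \<in> \<Theta>(\<lambda>n. real n ^ e)"
proof (rule bigthetaI)
  have "(n - m) choose e \<le> n ^ e" for n
  proof (cases "e \<le> n - m")
    case True
    then have "(n - m) choose e \<le> (n - m) ^ e" by (rule binomial_le_pow)
    also have "\<dots> \<le> n ^ e" by (intro power_mono) auto
    finally show ?thesis .
  qed (simp add: binomial_eq_0)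
  then have "real (if n < m then 0 else (n - m) choose e) \<le> real n ^ e" for n
    by (auto simp flip: of_nat_power)
  then show "(\<lambda>n. real (if n < m then 0 else (n - m) choose e)) \<in> O(\<lambda>n. real n ^ e)"
    by (intro bigoI[of _ 1]) simp
  have "\<forall>\<^sub>F n in sequentially. (1 / (2 * real e)) ^ e * norm (real n ^ e)
      \<le> norm (real (if n < m then 0 else (n - m) choose e))"
    using eventually_ge_at_top[of "2 * m + e"]
  proof eventually_elim
    case (elim n)
    \<comment> \<open>For \<open>n\<close> at least \<open>2 * m + e\<close>, both
      \<open>n - m \<ge> n / 2\<close>, the source of the factor 2 in the constant, and
      \<open>e \<le> n - m\<close> hold.\<close>
    have "(1 / (2 * real e)) ^ e * norm (real n ^ e) = ((real n / 2) / real e) ^ e"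
      by (simp add: power_divide power_mult_distrib)
    also have "\<dots> \<le> (real (n - m) / real e) ^ e"
      using elim by (intro power_mono divide_right_mono) auto
    also have "\<dots> \<le> real ((n - m) choose e)"
      by (rule binomial_ge_n_over_k_pow_k) (use elim in auto)
    finally show ?case using elim by auto
  qed
  \<comment> \<open>For \<open>e = 0\<close> the base is \<open>1 / 0 = 0\<close>, and
    \<open>0 ^ 0 = 1\<close> is still positive.\<close>
  moreover have "(1 / (2 * real e)) ^ e > 0" by (cases e) auto
  ultimately show "(\<lambda>n. real (if n < m then 0 else (n - m) choose e)) \<in> \<Omega>(\<lambda>n. real n ^ e)"
    by (intro landau_omega.bigI)
qed

theorem theorem3p1:
  fixes a b :: 's
  assumes "a \<noteq> b"
  shows
    "(\<forall>d \<ge> (1::nat). \<exists>U. rational_subset (free_group {a, b}) (free_basis {a, b}) U \<and>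
        (\<lambda>n. real (conj_growth (free_group {a, b}) (free_basis {a, b}) U n))
          \<in> \<Theta>(\<lambda>n. real n ^ (d - 1)) \<and>
        rational_fps (Abs_fps (\<lambda>n.
          of_nat (conj_growth (free_group {a, b}) (free_basis {a, b}) U n) :: rat)))
     \<and>
     (\<forall>U. rational_subset (free_group {a, b}) (free_basis {a, b}) U \<longrightarrow>
        (\<exists>p :: real poly. \<forall>n.
           real (conj_growth (free_group {a, b}) (free_basis {a, b}) U n) \<le> poly p (real n)) \<or>
        limsup (\<lambda>n. ereal (root n
           (real (conj_growth (free_group {a, b}) (free_basis {a, b}) U n)))) > 1)"
proof (intro conjI allI impI)
  fix d :: nat
  let ?U = "marked_words a b (d - 1)"
  have c: "conj_growth (free_group {a, b}) (free_basis {a, b}) ?U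
      = (\<lambda>n. if n < 3 then 0 else (n - 3) choose (d - 1))"
    by (rule ext) (rule conj_growth_marked_words[OF assms])
  show "\<exists>U. rational_subset (free_group {a, b}) (free_basis {a, b}) U \<and>
      (\<lambda>n. real (conj_growth (free_group {a, b}) (free_basis {a, b}) U n))
        \<in> \<Theta>(\<lambda>n. real n ^ (d - 1)) \<and>
      rational_fps (Abs_fps (\<lambda>n.
        of_nat (conj_growth (free_group {a, b}) (free_basis {a, b}) U n) :: rat))"
    by (rule exI[of _ ?U], unfold c, intro conjI rational_subset_marked_words[OF assms]
        bigtheta_shifted_binomial rational_fps_shifted_binomial)
qed (rule conj_growth_rational_dichotomy, simp)

end
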